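(* Let $(A,\cdot)$ be an anti-pre-Lie algebra and fix a representation $(V,\rho,\mu)$ of $(A,\cdot)$. Abelian extensions of $(A,\cdot)$ by $V$ that induce the given representation $(V,\rho,\mu)$ are classified, up to isomorphism of extensions, by $H^2(A;V)$. That is, sending such an extension $\hat A$ to the class in $H^2(A;V)$ of the 2-cocycle $\theta(x,y)=s(x)\cdot_{\hat A}s(y)-s(x\cdot y)$, where $s$ is any section of $\hat A$, gives a well-defined bijection between the isomorphism classes of abelian extensions of $(A,\cdot)$ by $V$ inducing $(V,\rho,\mu)$ and $H^2(A;V)$.
   Context: All vector spaces are over a field $\mathbb K$. An anti-pre-Lie algebra is a vector space $A$ with a bilinear product $\cdot$ such that for all $x,y,z\in A$, with $[x,y]=x\cdot y-y\cdot x$: (1) $x\cdot(y\cdot z)-y\cdot(x\cdot z)=[y,x]\cdot z$; (2) $[x,y]\cdot z+[y,z]\cdot x+[z,x]\cdot y=0$. Morphisms are linear maps preserving products. A representation of $(A,\cdot)$ on a vector space $V$, written $(V,\rho,\mu)$, is a pair of linear maps $\rho,\mu:A\to\mathfrak{gl}(V)$ such that for all $x,y\in A$: $\rho(x)\rho(y)-\rho(y)\rho(x)=\rho([y,x])$; $\mu(x\cdot y)-\rho(x)\mu(y)=\mu(y)\rho(x)-\mu(y)\mu(x)$; $\mu(y)\mu(x)-\mu(x)\mu(y)+\rho([x,y])=\mu(y)\rho(x)-\mu(x)\rho(y)$. Cohomology: $Z^2(A;V)$ is the space of linear maps $f:A\otimes A\to V$ such that for all $x,y,z\in A$, $\rho(x)f(y,z)-\rho(y)f(x,z)-\mu(z)f(y,x)+\mu(z)f(x,y)-f(y,x\cdot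 z)+f(x,y\cdot z)+f([x,y],z)=0$ and $\mu(x)(f(y,z)-f(z,y))+\mu(y)(f(z,x)-f(x,z))+\mu(z)(f(x,y)-f(y,x))+f([x,y],z)+f([y,z],x)+f([z,x],y)=0$. $B^2(A;V)$ is the space of maps $\mathrm d^1\varphi(x,y)=\rho(x)\varphi(y)+\mu(y)\varphi(x)-\varphi(x\cdot y)$ with $\varphi:A\to V$ linear; $B^2(A;V)\subset Z^2(A;V)$ and $H^2(A;V)=Z^2(A;V)/B^2(A;V)$. An abelian extension of $(A,\cdot)$ by a vector space $V$ (viewed as an anti-pre-Lie algebra with zero product) is a short exact sequence of anti-pre-Lie algebras $0\to V\xrightarrow{\iota}\hat A\xrightarrow{p}A\to0$; $V$ is identified with $\iota(V)$. A section is a linear map $s:A\to\hat A$ with $p\circ s=\mathrm{Id}_A$. The extension induces the representation of $A$ on $V$ given by $x\mapsto(u\mapsto s(x)\cdot_{\hat A}u)$ (for $\rho$) and $x\mapsto(u\mapsto u\cdot_{\hat A}s(x))$ (for $\mu$), which does not depend on the section $s$; and $\theta$ is then a 2-cocycle. Two abelian extensions $(\hat A_1,\iota_1,p_1)$, $(\hat A_2,\iota_2,p_2)$ of $A$ by $V$ are isomorphic if there is an anti-pre-Lie algebra isomorphism $\zeta:\hat A_1\to\hat A_2$ with $\zeta\circ\iota_1=\iota_2$ and $p_2\circ\zeta=p_1$. *)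

theory Defs
  imports "HOL-Algebra.Module" "HOL-Algebra.AbelCoset"
begin

text \<open>
  A vector space over a field \<open>K\<close> is a \<open>module K V\<close> with \<open>field K\<close>. The record type of modules
  extends that of rings, so its component \<open>mult\<close> can carry the product of a (non-associative)
  algebra; the component \<open>one\<close> is never used, and \<open>mult\<close> is not used for plain vector spaces.
\<close>

definition linear_map ::
    "('k, 'm) ring_scheme \<Rightarrow> ('k, 'v) module \<Rightarrow> ('k, 'w) module \<Rightarrow> ('v \<Rightarrow> 'w) \<Rightarrow> bool" where
  "linear_map K V W f \<longleftrightarrow>
     f \<in> hom (add_monoid V) (add_monoid W) \<and>
     (\<forall>a \<in> carrier K. \<forall>u \<in> carrier V. f (a \<odot>\<^bsub>V\<^esub> u) = a \<odot>\<^bsub>W\<^esub> f u)"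

text \<open>Linear maps on a tensor product are given as bilinear maps.\<close>

definition bilinear_map ::
    "('k, 'm) ring_scheme \<Rightarrow> ('k, 'u) module \<Rightarrow> ('k, 'v) module \<Rightarrow> ('k, 'w) module \<Rightarrow>
     ('u \<Rightarrow> 'v \<Rightarrow> 'w) \<Rightarrow> bool" where
  "bilinear_map K U V W f \<longleftrightarrow>
     (\<forall>x \<in> carrier U. linear_map K V W (f x)) \<and>
     (\<forall>y \<in> carrier V. linear_map K U W (\<lambda>x. f x y))"

definition commutator :: "('k, 'a) module \<Rightarrow> 'a \<Rightarrow> 'a \<Rightarrow> 'a" where
  "commutator A x y = x \<otimes>\<^bsub>A\<^esub> y \<ominus>\<^bsub>A\<^esub> y \<otimes>\<^bsub>A\<^esub> x"

locale anti_pre_lie_algebra = K?: field K + module K A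
  for K :: "('k, 'm) ring_scheme" (structure) and A :: "('k, 'a) module" (structure) +
  assumes bilinear_mult: "bilinear_map K A A A (mult A)"
    and anti_pre_lie:
      "\<lbrakk>x \<in> carrier A; y \<in> carrier A; z \<in> carrier A\<rbrakk> \<Longrightarrow>
       x \<otimes>\<^bsub>A\<^esub> (y \<otimes>\<^bsub>A\<^esub> z) \<ominus>\<^bsub>A\<^esub> y \<otimes>\<^bsub>A\<^esub> (x \<otimes>\<^bsub>A\<^esub> z) = commutator A y x \<otimes>\<^bsub>A\<^esub> z"
    and commutator_cyclic:
      "\<lbrakk>x \<in> carrier A; y \<in> carrier A; z \<in> carrier A\<rbrakk> \<Longrightarrow>
       commutator A x y \<otimes>\<^bsub>A\<^esub> z \<oplus>\<^bsub>A\<^esub> commutator A y z \<otimes>\<^bsub>A\<^esub> x \<oplus>\<^bsub>A\<^esub> commutator A z x \<otimes>\<^bsub>A\<^esub> y = \<zero>\<^bsub>A\<^esub>"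

definition algebra_hom ::
    "('k, 'm) ring_scheme \<Rightarrow> ('k, 'a) module \<Rightarrow> ('k, 'b) module \<Rightarrow> ('a \<Rightarrow> 'b) \<Rightarrow> bool" where
  "algebra_hom K A B f \<longleftrightarrow>
     linear_map K A B f \<and>
     (\<forall>x \<in> carrier A. \<forall>y \<in> carrier A. f (x \<otimes>\<^bsub>A\<^esub> y) = f x \<otimes>\<^bsub>B\<^esub> f y)"

text \<open>
  Bilinearity of \<open>\<rho>\<close> says that \<open>\<rho>\<close> is a linear map from \<open>A\<close> to the linear endomorphisms
  of \<open>V\<close>; likewise for \<open>\<mu>\<close>. The identities between endomorphisms are stated pointwise.
\<close>

locale anti_pre_lie_representation = A?: anti_pre_lie_algebra K A + V?: module K V
  for K :: "('k, 'm) ring_scheme" (structure) and A :: "('k, 'a) module" (structure)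
    and V :: "('k, 'v) module" (structure)
    and \<rho> :: "'a \<Rightarrow> 'v \<Rightarrow> 'v" and \<mu> :: "'a \<Rightarrow> 'v \<Rightarrow> 'v" +
  assumes bilinear_rho: "bilinear_map K A V V \<rho>"
    and bilinear_mu: "bilinear_map K A V V \<mu>"
    and rho_commutator:
      "\<lbrakk>x \<in> carrier A; y \<in> carrier A; v \<in> carrier V\<rbrakk> \<Longrightarrow>
       \<rho> x (\<rho> y v) \<ominus>\<^bsub>V\<^esub> \<rho> y (\<rho> x v) = \<rho> (commutator A y x) v"
    and mu_mult:
      "\<lbrakk>x \<in> carrier A; y \<in> carrier A; v \<in> carrier V\<rbrakk> \<Longrightarrow>
       \<mu> (x \<otimes>\<^bsub>A\<^esub> y) v \<ominus>\<^bsub>V\<^esub> \<rho> x (\<mu> y v) = \<mu> y (\<rho> x v) \<ominus>\<^bsub>V\<^esub> \<mu> y (\<mu> x v)"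
    and mu_commutator:
      "\<lbrakk>x \<in> carrier A; y \<in> carrier A; v \<in> carrier V\<rbrakk> \<Longrightarrow>
       \<mu> y (\<mu> x v) \<ominus>\<^bsub>V\<^esub> \<mu> x (\<mu> y v) \<oplus>\<^bsub>V\<^esub> \<rho> (commutator A x y) v
         = \<mu> y (\<rho> x v) \<ominus>\<^bsub>V\<^esub> \<mu> x (\<rho> y v)"

text \<open>
  Cochains are extensional functions (\<open>undefined\<close> outside the carriers), so that equality in HOL
  is equality of maps on the carriers.
\<close>

definition cocycles2 ::
    "('k, 'm) ring_scheme \<Rightarrow> ('k, 'a) module \<Rightarrow> ('k, 'v) module \<Rightarrow>
     ('a \<Rightarrow> 'v \<Rightarrow> 'v) \<Rightarrow> ('a \<Rightarrow> 'v \<Rightarrow> 'v) \<Rightarrow> ('a \<Rightarrow> 'a \<Rightarrow> 'v) set" where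
  "cocycles2 K A V \<rho> \<mu> =
     {f \<in> carrier A \<rightarrow>\<^sub>E (carrier A \<rightarrow>\<^sub>E carrier V).
        bilinear_map K A A V f \<and>
        (\<forall>x \<in> carrier A. \<forall>y \<in> carrier A. \<forall>z \<in> carrier A.
           \<rho> x (f y z) \<ominus>\<^bsub>V\<^esub> \<rho> y (f x z) \<ominus>\<^bsub>V\<^esub> \<mu> z (f y x) \<oplus>\<^bsub>V\<^esub> \<mu> z (f x y)
             \<ominus>\<^bsub>V\<^esub> f y (x \<otimes>\<^bsub>A\<^esub> z) \<oplus>\<^bsub>V\<^esub> f x (y \<otimes>\<^bsub>A\<^esub> z) \<oplus>\<^bsub>V\<^esub> f (commutator A x y) z = \<zero>\<^bsub>V\<^esub>) \<and>
        (\<forall>x \<in> carrier A. \<forall>y \<in> carrier A. \<forall>z \<in> carrier A.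
           \<mu> x (f y z \<ominus>\<^bsub>V\<^esub> f z y) \<oplus>\<^bsub>V\<^esub> \<mu> y (f z x \<ominus>\<^bsub>V\<^esub> f x z) \<oplus>\<^bsub>V\<^esub> \<mu> z (f x y \<ominus>\<^bsub>V\<^esub> f y x)
             \<oplus>\<^bsub>V\<^esub> f (commutator A x y) z \<oplus>\<^bsub>V\<^esub> f (commutator A y z) x \<oplus>\<^bsub>V\<^esub> f (commutator A z x) y
             = \<zero>\<^bsub>V\<^esub>)}"

definition cocycle_space2 ::
    "('k, 'm) ring_scheme \<Rightarrow> ('k, 'a) module \<Rightarrow> ('k, 'v) module \<Rightarrow>
     ('a \<Rightarrow> 'v \<Rightarrow> 'v) \<Rightarrow> ('a \<Rightarrow> 'v \<Rightarrow> 'v) \<Rightarrow> ('k, 'a \<Rightarrow> 'a \<Rightarrow> 'v) module" where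
  "cocycle_space2 K A V \<rho> \<mu> =
     \<lparr>carrier = cocycles2 K A V \<rho> \<mu>,
      mult = undefined,
      one = undefined,
      zero = (\<lambda>x \<in> carrier A. \<lambda>y \<in> carrier A. \<zero>\<^bsub>V\<^esub>),
      add = (\<lambda>f g. \<lambda>x \<in> carrier A. \<lambda>y \<in> carrier A. f x y \<oplus>\<^bsub>V\<^esub> g x y),
      smult = (\<lambda>a f. \<lambda>x \<in> carrier A. \<lambda>y \<in> carrier A. a \<odot>\<^bsub>V\<^esub> f x y)\<rparr>"

definition coboundary1 ::
    "('k, 'a) module \<Rightarrow> ('k, 'v) module \<Rightarrow> ('a \<Rightarrow> 'v \<Rightarrow> 'v) \<Rightarrow> ('a \<Rightarrow> 'v \<Rightarrow> 'v) \<Rightarrow>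
     ('a \<Rightarrow> 'v) \<Rightarrow> 'a \<Rightarrow> 'a \<Rightarrow> 'v" where
  "coboundary1 A V \<rho> \<mu> \<phi> =
     (\<lambda>x \<in> carrier A. \<lambda>y \<in> carrier A. \<rho> x (\<phi> y) \<oplus>\<^bsub>V\<^esub> \<mu> y (\<phi> x) \<ominus>\<^bsub>V\<^esub> \<phi> (x \<otimes>\<^bsub>A\<^esub> y))"

definition coboundaries2 ::
    "('k, 'm) ring_scheme \<Rightarrow> ('k, 'a) module \<Rightarrow> ('k, 'v) module \<Rightarrow>
     ('a \<Rightarrow> 'v \<Rightarrow> 'v) \<Rightarrow> ('a \<Rightarrow> 'v \<Rightarrow> 'v) \<Rightarrow> ('a \<Rightarrow> 'a \<Rightarrow> 'v) set" where
  "coboundaries2 K A V \<rho> \<mu> = {coboundary1 A V \<rho> \<mu> \<phi> |\<phi>. linear_map K A V \<phi>}"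

text \<open>The second cohomology, as the set of cosets of the coboundaries in the space of cocycles.\<close>

definition cohomology2 ::
    "('k, 'm) ring_scheme \<Rightarrow> ('k, 'a) module \<Rightarrow> ('k, 'v) module \<Rightarrow>
     ('a \<Rightarrow> 'v \<Rightarrow> 'v) \<Rightarrow> ('a \<Rightarrow> 'v \<Rightarrow> 'v) \<Rightarrow> ('a \<Rightarrow> 'a \<Rightarrow> 'v) set set" where
  "cohomology2 K A V \<rho> \<mu> =
     a_rcosets\<^bsub>cocycle_space2 K A V \<rho> \<mu>\<^esub> (coboundaries2 K A V \<rho> \<mu>)"

definition cohomology_class2 ::
    "('k, 'm) ring_scheme \<Rightarrow> ('k, 'a) module \<Rightarrow> ('k, 'v) module \<Rightarrow>
     ('a \<Rightarrow> 'v \<Rightarrow> 'v) \<Rightarrow> ('a \<Rightarrow> 'v \<Rightarrow> 'v) \<Rightarrow> ('a \<Rightarrow> 'a \<Rightarrow> 'v) \<Rightarrow> ('a \<Rightarrow> 'a \<Rightarrow> 'v) set" where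
  "cohomology_class2 K A V \<rho> \<mu> f =
     coboundaries2 K A V \<rho> \<mu> +>\<^bsub>cocycle_space2 K A V \<rho> \<mu>\<^esub> f"

definition zero_product :: "('k, 'v) module \<Rightarrow> ('k, 'v) module" where
  "zero_product V = V\<lparr>mult := \<lambda>_ _. \<zero>\<^bsub>V\<^esub>\<rparr>"

text \<open>An extension is a triple \<open>(E, \<iota>, p)\<close> of the middle term and the two maps.\<close>

type_synonym ('k, 'a, 'v, 'e) extension = "('k, 'e) module \<times> ('v \<Rightarrow> 'e) \<times> ('e \<Rightarrow> 'a)"

definition abelian_extension ::
    "('k, 'm) ring_scheme \<Rightarrow> ('k, 'a) module \<Rightarrow> ('k, 'v) module \<Rightarrow>
     ('k, 'a, 'v, 'e) extension \<Rightarrow> bool" where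
  "abelian_extension K A V = (\<lambda>(E, \<iota>, p).
     anti_pre_lie_algebra K E \<and>
     algebra_hom K (zero_product V) E \<iota> \<and>
     algebra_hom K E A p \<and>
     inj_on \<iota> (carrier V) \<and>
     \<iota> ` carrier V = a_kernel E A p \<and>
     p ` carrier E = carrier A)"

definition extension_section ::
    "('k, 'm) ring_scheme \<Rightarrow> ('k, 'a) module \<Rightarrow> ('k, 'a, 'v, 'e) extension \<Rightarrow> ('a \<Rightarrow> 'e) \<Rightarrow> bool" where
  "extension_section K A = (\<lambda>(E, \<iota>, p) s.
     linear_map K A E s \<and> (\<forall>x \<in> carrier A. p (s x) = x))"

definition induces_representation ::
    "('k, 'm) ring_scheme \<Rightarrow> ('k, 'a) module \<Rightarrow> ('k, 'v) module \<Rightarrow>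
     ('a \<Rightarrow> 'v \<Rightarrow> 'v) \<Rightarrow> ('a \<Rightarrow> 'v \<Rightarrow> 'v) \<Rightarrow> ('k, 'a, 'v, 'e) extension \<Rightarrow> bool" where
  "induces_representation K A V \<rho> \<mu> = (\<lambda>(E, \<iota>, p).
     \<forall>s. extension_section K A (E, \<iota>, p) s \<longrightarrow>
       (\<forall>x \<in> carrier A. \<forall>u \<in> carrier V.
          \<iota> (\<rho> x u) = s x \<otimes>\<^bsub>E\<^esub> \<iota> u \<and> \<iota> (\<mu> x u) = \<iota> u \<otimes>\<^bsub>E\<^esub> s x))"

text \<open>
  The defect \<open>s x \<cdot> s y - s (x \<cdot> y)\<close> lies in the image of \<open>\<iota>\<close>; it is pulled back to \<open>V\<close>.
\<close>

definition extension_cocycle ::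
    "('k, 'a) module \<Rightarrow> ('k, 'v) module \<Rightarrow> ('k, 'a, 'v, 'e) extension \<Rightarrow> ('a \<Rightarrow> 'e) \<Rightarrow>
     'a \<Rightarrow> 'a \<Rightarrow> 'v" where
  "extension_cocycle A V = (\<lambda>(E, \<iota>, p) s.
     \<lambda>x \<in> carrier A. \<lambda>y \<in> carrier A.
       the_inv_into (carrier V) \<iota> (s x \<otimes>\<^bsub>E\<^esub> s y \<ominus>\<^bsub>E\<^esub> s (x \<otimes>\<^bsub>A\<^esub> y)))"

definition extension_isomorphic ::
    "('k, 'm) ring_scheme \<Rightarrow> ('k, 'v) module \<Rightarrow>
     ('k, 'a, 'v, 'e) extension \<Rightarrow> ('k, 'a, 'v, 'f) extension \<Rightarrow> bool" where
  "extension_isomorphic K V = (\<lambda>(E1, \<iota>1, p1) (E2, \<iota>2, p2).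
     \<exists>\<zeta>. algebra_hom K E1 E2 \<zeta> \<and> bij_betw \<zeta> (carrier E1) (carrier E2) \<and>
         (\<forall>u \<in> carrier V. \<zeta> (\<iota>1 u) = \<iota>2 u) \<and>
         (\<forall>e \<in> carrier E1. p2 (\<zeta> e) = p1 e))"

definition extensions ::
    "('k, 'm) ring_scheme \<Rightarrow> ('k, 'a) module \<Rightarrow> ('k, 'v) module \<Rightarrow>
     ('a \<Rightarrow> 'v \<Rightarrow> 'v) \<Rightarrow> ('a \<Rightarrow> 'v \<Rightarrow> 'v) \<Rightarrow> ('k, 'a, 'v, 'e) extension set" where
  "extensions K A V \<rho> \<mu> =
     {X. abelian_extension K A V X \<and> induces_representation K A V \<rho> \<mu> X}"

definition extension_iso_rel ::
    "('k, 'm) ring_scheme \<Rightarrow> ('k, 'a) module \<Rightarrow> ('k, 'v) module \<Rightarrow>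
     ('a \<Rightarrow> 'v \<Rightarrow> 'v) \<Rightarrow> ('a \<Rightarrow> 'v \<Rightarrow> 'v) \<Rightarrow> ('k, 'a, 'v, 'e) extension rel" where
  "extension_iso_rel K A V \<rho> \<mu> =
     {(X, Y) \<in> extensions K A V \<rho> \<mu> \<times> extensions K A V \<rho> \<mu>. extension_isomorphic K V X Y}"

end

theory Submission
  imports Defs
begin

text \<open>
  For a bilinear map \<open>f : A \<times> A \<rightarrow> V\<close>, twist the product of the semidirect product on \<open>A \<times> V\<close> to
  \<open>(x, u) \<cdot> (y, v) = (x \<cdot> y, f x y + \<rho> x v + \<mu> y u)\<close>. Evaluating the two axioms on triples of
  elements shows that this is an anti-pre-Lie algebra if and only if \<open>f\<close> is a 2-cocycle.
  A section \<open>s\<close> of an extension (it exists because subspaces have complements) identifies the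
  extension with the product twisted by its \<open>\<theta>\<close>, so \<open>\<theta>\<close> is a cocycle and determines
  the extension up to isomorphism. Two sections differ by a linear map \<open>\<phi> : A \<rightarrow> V\<close>, which changes
  \<open>\<theta>\<close> by \<open>d\<^sup>1 \<phi>\<close>; an isomorphism of extensions carries sections to sections with the same
  \<open>\<theta>\<close>. Hence two extensions are isomorphic if and only if their cocycles are cohomologous, and the
  twisted products realise all cocycles.
\<close>

text \<open>No cocycle identity is verified inside an extension. At a fixed triple of pairs, the
  axioms for a twisted product are equivalent to the cocycle conditions at the first components: the
  vector components drop out by the representation axioms. A twisted product is a module for every
  \<open>f\<close>, so the comparison map to an extension can be studied before
  \<open>\<theta>\<close> is known to be a cocycle, and the axioms are then pulled back along it.
  The other constraint is typing. Isomorphism classes can only be formed among extensions on one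
  type \<open>'e\<close>, whereas twisted products live on pairs. A middle term has as many elements
  as \<open>carrier A \<times> carrier V\<close>, so asking for an injection \<open>j\<close> of
  this set into \<open>'e\<close> loses no generality; a twisted product is copied into
  \<open>'e\<close> along \<open>j\<close>. Two extensions on \<open>'e\<close> are still compared
  through a twisted product on pairs, which is why isomorphism of extensions relates different
  types.\<close>

text \<open>
  The library sets up the method \<open>algebra\<close> for rings only. Closure rules for \<open>\<rho>\<close>, \<open>\<mu>\<close> and the like
  are added to the same simpset below, since the method must see that the summands lie in the carrier.
\<close>

lemmas (in abelian_group) abelian_group_simprules
  [algebra abelian_group "zero G" "add G" "a_inv G" "a_minus G"] =
  a_closed zero_closed a_inv_closed minus_closed
  a_assoc l_zero l_neg a_comm a_minus_def
  r_zero r_neg r_neg2 r_neg1 minus_add minus_minus add.inv_one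
  a_lcomm

section \<open>Cancellation identities in abelian groups\<close>

lemma (in abelian_group) add_diff_cancel:
  assumes "a \<in> carrier G" "b \<in> carrier G"
  shows "a \<oplus> (b \<ominus> a) = b"
  using assms by algebra

text \<open>This is the shape of the second components when the anti-pre-Lie axiom is expanded at
  \<open>(x, u)\<close>, \<open>(y, v)\<close>, \<open>(z, w)\<close> in a twisted product. The
  surviving letters are the terms with \<open>f\<close>; \<open>w1\<close> and \<open>w2\<close> are
  the terms in \<open>w\<close>; \<open>a\<close> and \<open>b\<close> are
  \<open>\<rho> x (\<mu> z v)\<close> and \<open>\<rho> y (\<mu> z u)\<close>; \<open>c\<close> and
  \<open>d\<close> are \<open>\<mu> z (\<delta> y u)\<close> and
  \<open>\<mu> z (\<delta> x v)\<close>, where \<open>\<delta>\<close> is the difference of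
  \<open>\<rho>\<close> and \<open>\<mu>\<close>.\<close>

lemma (in abelian_group) anti_pre_lie_cancel:
  assumes "f1 \<in> carrier G" "f2 \<in> carrier G" "r1 \<in> carrier G" "r2 \<in> carrier G"
    "w1 \<in> carrier G" "w2 \<in> carrier G" "g1 \<in> carrier G" "g2 \<in> carrier G"
    "a \<in> carrier G" "b \<in> carrier G" "c \<in> carrier G" "d \<in> carrier G" "k \<in> carrier G"
  shows "f1 \<oplus> (r1 \<oplus> w1 \<oplus> a) \<oplus> (b \<oplus> c) \<ominus> (f2 \<oplus> (r2 \<oplus> w2 \<oplus> b) \<oplus> (a \<oplus> d))
      \<ominus> (k \<oplus> (w1 \<ominus> w2) \<oplus> (g2 \<ominus> g1 \<oplus> c \<ominus> d))
    = r1 \<ominus> r2 \<ominus> g2 \<oplus> g1 \<ominus> f2 \<oplus> f1 \<oplus> \<ominus> k"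
proof -
  have diff: "(x \<oplus> y) \<ominus> (z \<oplus> t) = (x \<ominus> z) \<oplus> (y \<ominus> t)"
    if "x \<in> carrier G" "y \<in> carrier G" "z \<in> carrier G" "t \<in> carrier G" for x y z t
    using that by algebra
  have assoc: "g2 \<ominus> g1 \<oplus> c \<ominus> d = (g2 \<ominus> g1) \<oplus> (c \<ominus> d)"
    using assms by (simp add: a_minus_def a_assoc)
  \<comment> \<open>Grouped into differences, \<open>a \<ominus> b\<close> meets its negative, while
    \<open>z\<close> and \<open>t\<close> occur on both sides of the subtraction.\<close>
  have cancel: "x \<oplus> (y \<oplus> z \<oplus> (a \<ominus> b)) \<oplus> ((b \<ominus> a) \<oplus> t) \<ominus> (k \<oplus> z \<oplus> (g \<oplus> t)) = x \<oplus> y \<ominus> g \<ominus> k"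
    if "x \<in> carrier G" "y \<in> carrier G" "z \<in> carrier G" "t \<in> carrier G" "g \<in> carrier G" for x y z t g
    using that assms by algebra
  have "f1 \<oplus> (r1 \<oplus> w1 \<oplus> a) \<oplus> (b \<oplus> c) \<ominus> (f2 \<oplus> (r2 \<oplus> w2 \<oplus> b) \<oplus> (a \<oplus> d))
      \<ominus> (k \<oplus> (w1 \<ominus> w2) \<oplus> (g2 \<ominus> g1 \<oplus> c \<ominus> d))
    = (f1 \<ominus> f2) \<oplus> ((r1 \<ominus> r2) \<oplus> (w1 \<ominus> w2) \<oplus> (a \<ominus> b)) \<oplus> ((b \<ominus> a) \<oplus> (c \<ominus> d))
      \<ominus> (k \<oplus> (w1 \<ominus> w2) \<oplus> ((g2 \<ominus> g1) \<oplus> (c \<ominus> d)))"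
    using assms by (simp add: diff assoc)
  also have "\<dots> = (f1 \<ominus> f2) \<oplus> (r1 \<ominus> r2) \<ominus> (g2 \<ominus> g1) \<ominus> k"
    using assms by (intro cancel) simp_all
  also have "\<dots> = r1 \<ominus> r2 \<ominus> g2 \<oplus> g1 \<ominus> f2 \<oplus> f1 \<oplus> \<ominus> k"
    using assms by algebra
  finally show ?thesis .
qed

text \<open>The letters \<open>a\<close>, \<open>b\<close>, \<open>c\<close>, \<open>d\<close>,
  \<open>e\<close>, \<open>h\<close> are the six mixed terms such as
  \<open>\<mu> y (\<delta> x w)\<close>. Each arises once from \<open>\<rho>\<close> of a commutator
  and once, with the opposite sign, from the \<open>\<mu>\<close> part of another summand of the
  cyclic sum.\<close>

lemma (in abelian_group) cyclic_sum_cancel: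
  assumes "f1 \<in> carrier G" "f2 \<in> carrier G" "f3 \<in> carrier G"
    "g1 \<in> carrier G" "g2 \<in> carrier G" "g3 \<in> carrier G"
    "a \<in> carrier G" "b \<in> carrier G" "c \<in> carrier G"
    "d \<in> carrier G" "e \<in> carrier G" "h \<in> carrier G"
  shows "f1 \<oplus> (a \<ominus> b) \<oplus> (g1 \<oplus> e \<ominus> h) \<oplus> (f2 \<oplus> (h \<ominus> c) \<oplus> (g2 \<oplus> b \<ominus> d))
      \<oplus> (f3 \<oplus> (d \<ominus> e) \<oplus> (g3 \<oplus> c \<ominus> a))
    = g2 \<oplus> g3 \<oplus> g1 \<oplus> f1 \<oplus> f2 \<oplus> f3"
  using assms by algebra

subsection \<open>Linear and bilinear maps\<close>

lemma linear_mapI: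
  assumes "\<And>x. x \<in> carrier V \<Longrightarrow> f x \<in> carrier W"
    and "\<And>x y. \<lbrakk>x \<in> carrier V; y \<in> carrier V\<rbrakk> \<Longrightarrow> f (x \<oplus>\<^bsub>V\<^esub> y) = f x \<oplus>\<^bsub>W\<^esub> f y"
    and "\<And>a x. \<lbrakk>a \<in> carrier K; x \<in> carrier V\<rbrakk> \<Longrightarrow> f (a \<odot>\<^bsub>V\<^esub> x) = a \<odot>\<^bsub>W\<^esub> f x"
  shows "linear_map K V W f"
  using assms by (auto simp: linear_map_def hom_def)

lemma linear_mapD:
  assumes "linear_map K V W f"
  shows linear_map_closed: "x \<in> carrier V \<Longrightarrow> f x \<in> carrier W"
    and linear_map_add: "\<lbrakk>x \<in> carrier V; y \<in> carrier V\<rbrakk> \<Longrightarrow> f (x \<oplus>\<^bsub>V\<^esub> y) = f x \<oplus>\<^bsub>W\<^esub> f y"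
    and linear_map_smult: "\<lbrakk>a \<in> carrier K; x \<in> carrier V\<rbrakk> \<Longrightarrow> f (a \<odot>\<^bsub>V\<^esub> x) = a \<odot>\<^bsub>W\<^esub> f x"
  using assms by (auto simp: linear_map_def hom_def)

locale linear_mapping = V?: module K V + W?: module K W
  for K :: "('k, 'm) ring_scheme" (structure)
    and V :: "('k, 'v) module" (structure) and W :: "('k, 'w) module" (structure) +
  fixes f
  assumes linear: "linear_map K V W f"
begin

lemmas closed [simp] = linear_map_closed[OF linear]
lemmas additive = linear_map_add[OF linear]
lemmas homogeneous = linear_map_smult[OF linear]

lemma zero: "f \<zero>\<^bsub>V\<^esub> = \<zero>\<^bsub>W\<^esub>"
proof -
  have "f \<zero>\<^bsub>V\<^esub> \<oplus>\<^bsub>W\<^esub> f \<zero>\<^bsub>V\<^esub> = f \<zero>\<^bsub>V\<^esub>"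
    using additive[of "\<zero>\<^bsub>V\<^esub>" "\<zero>\<^bsub>V\<^esub>"] by simp
  then show ?thesis
    by (metis V.M.zero_closed closed W.M.add.l_cancel_one')
qed

lemma uminus: "x \<in> carrier V \<Longrightarrow> f (\<ominus>\<^bsub>V\<^esub> x) = \<ominus>\<^bsub>W\<^esub> f x"
  by (metis V.M.a_inv_closed V.M.l_neg W.M.minus_equality additive closed zero)

lemma diff: "\<lbrakk>x \<in> carrier V; y \<in> carrier V\<rbrakk> \<Longrightarrow> f (x \<ominus>\<^bsub>V\<^esub> y) = f x \<ominus>\<^bsub>W\<^esub> f y"
  by (simp add: a_minus_def additive uminus)

lemmas simps = additive homogeneous zero uminus diff

end

locale bilinear_mapping = U?: module K U + V?: module K V + W?: module K W
  for K :: "('k, 'm) ring_scheme" (structure) and U :: "('k, 'u) module" (structure)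
    and V :: "('k, 'v) module" (structure) and W :: "('k, 'w) module" (structure) +
  fixes f
  assumes bilinear: "bilinear_map K U V W f"
begin

lemma linear_right: "x \<in> carrier U \<Longrightarrow> linear_mapping K V W (f x)"
  using bilinear by (simp add: bilinear_map_def linear_mapping_def linear_mapping_axioms_def
      V.module_axioms W.module_axioms)

lemma linear_left: "y \<in> carrier V \<Longrightarrow> linear_mapping K U W (\<lambda>x. f x y)"
  using bilinear by (simp add: bilinear_map_def linear_mapping_def linear_mapping_axioms_def
      U.module_axioms W.module_axioms)

lemma closed [simp, algebra abelian_group "zero W" "add W" "a_inv W" "a_minus W"]:
  "\<lbrakk>x \<in> carrier U; y \<in> carrier V\<rbrakk> \<Longrightarrow> f x y \<in> carrier W"
  using linear_mapping.closed[OF linear_right] .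

lemmas simps = linear_mapping.simps[OF linear_right] linear_mapping.simps[OF linear_left]

end

lemma bilinear_mapI:
  assumes "\<And>x y. \<lbrakk>x \<in> carrier U; y \<in> carrier V\<rbrakk> \<Longrightarrow> f x y \<in> carrier W"
    and "\<And>x y z. \<lbrakk>x \<in> carrier U; y \<in> carrier V; z \<in> carrier V\<rbrakk>
      \<Longrightarrow> f x (y \<oplus>\<^bsub>V\<^esub> z) = f x y \<oplus>\<^bsub>W\<^esub> f x z"
    and "\<And>a x y. \<lbrakk>a \<in> carrier K; x \<in> carrier U; y \<in> carrier V\<rbrakk>
      \<Longrightarrow> f x (a \<odot>\<^bsub>V\<^esub> y) = a \<odot>\<^bsub>W\<^esub> f x y"
    and "\<And>x y z. \<lbrakk>x \<in> carrier U; y \<in> carrier U; z \<in> carrier V\<rbrakk>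
      \<Longrightarrow> f (x \<oplus>\<^bsub>U\<^esub> y) z = f x z \<oplus>\<^bsub>W\<^esub> f y z"
    and "\<And>a x y. \<lbrakk>a \<in> carrier K; x \<in> carrier U; y \<in> carrier V\<rbrakk>
      \<Longrightarrow> f (a \<odot>\<^bsub>U\<^esub> x) y = a \<odot>\<^bsub>W\<^esub> f x y"
  shows "bilinear_map K U V W f"
  using assms by (auto simp: bilinear_map_def intro!: linear_mapI)

lemma (in abelian_group) diff_eq_zero_iff:
  assumes "a \<in> carrier G" "b \<in> carrier G"
  shows "a \<ominus> b = \<zero> \<longleftrightarrow> a = b"
  using assms by (metis a_inv_closed a_minus_def minus_equality minus_minus r_neg)

context anti_pre_lie_algebra
begin

sublocale mult: bilinear_mapping K A A A "mult A"
  by unfold_locales (rule bilinear_mult)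

end

context anti_pre_lie_representation
begin

declare mult.closed [algebra abelian_group "zero V" "add V" "a_inv V" "a_minus V"]

sublocale \<rho>: bilinear_mapping K A V V \<rho>
  by unfold_locales (rule bilinear_rho)

sublocale \<mu>: bilinear_mapping K A V V \<mu>
  by unfold_locales (rule bilinear_mu)

end

subsection \<open>Twisted products\<close>

context anti_pre_lie_representation
begin

definition twisted_product where
  "twisted_product f =
     \<lparr>carrier = carrier A \<times> carrier V,
      mult = (\<lambda>(x, u) (y, v). (x \<otimes>\<^bsub>A\<^esub> y, f x y \<oplus>\<^bsub>V\<^esub> \<rho> x v \<oplus>\<^bsub>V\<^esub> \<mu> y u)),
      one = undefined,
      zero = (\<zero>\<^bsub>A\<^esub>, \<zero>\<^bsub>V\<^esub>),
      add = (\<lambda>(x, u) (y, v). (x \<oplus>\<^bsub>A\<^esub> y, u \<oplus>\<^bsub>V\<^esub> v)),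
      smult = (\<lambda>a (x, u). (a \<odot>\<^bsub>A\<^esub> x, a \<odot>\<^bsub>V\<^esub> u))\<rparr>"

lemma twisted_product_simps [simp]:
  "carrier (twisted_product f) = carrier A \<times> carrier V"
  "(x, u) \<otimes>\<^bsub>twisted_product f\<^esub> (y, v)
     = (x \<otimes>\<^bsub>A\<^esub> y, f x y \<oplus>\<^bsub>V\<^esub> \<rho> x v \<oplus>\<^bsub>V\<^esub> \<mu> y u)"
  "\<zero>\<^bsub>twisted_product f\<^esub> = (\<zero>\<^bsub>A\<^esub>, \<zero>\<^bsub>V\<^esub>)"
  "(x, u) \<oplus>\<^bsub>twisted_product f\<^esub> (y, v) = (x \<oplus>\<^bsub>A\<^esub> y, u \<oplus>\<^bsub>V\<^esub> v)"
  "a \<odot>\<^bsub>twisted_product f\<^esub> (x, u) = (a \<odot>\<^bsub>A\<^esub> x, a \<odot>\<^bsub>V\<^esub> u)"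
  by (simp_all add: twisted_product_def)

lemma abelian_group_twisted_product: "abelian_group (twisted_product f)"
proof (rule abelian_groupI)
  fix X assume "X \<in> carrier (twisted_product f)"
  then obtain x u where "X = (x, u)" "x \<in> carrier A" "u \<in> carrier V"
    by auto
  then show "\<exists>Y\<in>carrier (twisted_product f). Y \<oplus>\<^bsub>twisted_product f\<^esub> X = \<zero>\<^bsub>twisted_product f\<^esub>"
    by (intro bexI[of _ "(\<ominus>\<^bsub>A\<^esub> x, \<ominus>\<^bsub>V\<^esub> u)"]) (auto simp: A.M.l_neg V.M.l_neg)
qed (auto simp: A.M.a_ac V.M.a_ac)

text \<open>Only the product depends on \<open>f\<close>, so this holds for arbitrary
  \<open>f\<close> and is available for \<open>\<theta>\<close> before the cocycle property.\<close>

lemma module_twisted_product: "module K (twisted_product f)"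
  by (rule moduleI)
    (auto simp: abelian_group_twisted_product A.smult_l_distr A.smult_r_distr A.smult_assoc1
      V.smult_l_distr V.smult_r_distr V.smult_assoc1 A.K.is_cring)

lemma uminus_twisted_product [simp]:
  assumes "x \<in> carrier A" "u \<in> carrier V"
  shows "\<ominus>\<^bsub>twisted_product f\<^esub> (x, u) = (\<ominus>\<^bsub>A\<^esub> x, \<ominus>\<^bsub>V\<^esub> u)"
  by (rule abelian_group.minus_equality[OF abelian_group_twisted_product])
    (use assms in \<open>auto simp: A.M.l_neg V.M.l_neg\<close>)

lemma diff_twisted_product [simp]:
  assumes "x \<in> carrier A" "u \<in> carrier V" "y \<in> carrier A" "v \<in> carrier V"
  shows "(x, u) \<ominus>\<^bsub>twisted_product f\<^esub> (y, v) = (x \<ominus>\<^bsub>A\<^esub> y, u \<ominus>\<^bsub>V\<^esub> v)"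
  using assms by (simp add: a_minus_def)

lemma commutator_closed [simp, algebra abelian_group "zero V" "add V" "a_inv V" "a_minus V"]:
  "\<lbrakk>x \<in> carrier A; y \<in> carrier A\<rbrakk> \<Longrightarrow> commutator A x y \<in> carrier A"
  by (simp add: commutator_def)

lemma uminus_commutator:
  "\<lbrakk>x \<in> carrier A; y \<in> carrier A\<rbrakk> \<Longrightarrow> \<ominus>\<^bsub>A\<^esub> commutator A x y = commutator A y x"
  unfolding commutator_def by (simp add: A.M.minus_add A.M.a_comm a_minus_def)

lemma commutator_twisted_product:
  assumes "bilinear_mapping K A A V f"
    and "x \<in> carrier A" "u \<in> carrier V" "y \<in> carrier A" "v \<in> carrier V"
  shows "commutator (twisted_product f) (x, u) (y, v) =
    (commutator A x y, f x y \<oplus>\<^bsub>V\<^esub> \<rho> x v \<oplus>\<^bsub>V\<^esub> \<mu> y u \<ominus>\<^bsub>V\<^esub> (f y x \<oplus>\<^bsub>V\<^esub> \<rho> y u \<oplus>\<^bsub>V\<^esub> \<mu> x v))"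
proof -
  interpret f: bilinear_mapping K A A V f by fact
  show ?thesis
    using assms by (simp add: commutator_def)
qed

lemma bilinear_twisted_product:
  assumes "bilinear_mapping K A A V f"
  shows "bilinear_map K (twisted_product f) (twisted_product f) (twisted_product f)
    (mult (twisted_product f))"
proof -
  interpret f: bilinear_mapping K A A V f by fact
  show ?thesis
    by (rule bilinear_mapI)
      (auto simp: mult.simps f.simps \<rho>.simps \<mu>.simps V.smult_r_distr V.M.a_ac)
qed

text \<open>
  All mixed terms have the form \<open>\<mu> y (\<delta> x v)\<close>: in terms of these, the two conditions on \<open>\<mu>\<close> become
  rewrite rules and the cyclic sum cancels termwise.
\<close>

definition \<delta> :: "'a \<Rightarrow> 'v \<Rightarrow> 'v" where
  "\<delta> x v = \<rho> x v \<ominus>\<^bsub>V\<^esub> \<mu> x v"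

lemma delta_closed [simp, algebra abelian_group "zero V" "add V" "a_inv V" "a_minus V"]:
  "\<lbrakk>x \<in> carrier A; v \<in> carrier V\<rbrakk> \<Longrightarrow> \<delta> x v \<in> carrier V"
  by (simp add: \<delta>_def)

text \<open>In the semidirect product, \<open>\<delta> x v\<close> is the commutator of
  \<open>(x, 0)\<close> and \<open>(0, v)\<close>; the right side of \<open>mu_mult\<close> is
  \<open>\<mu> y\<close> applied to it.\<close>

lemma mu_mult_delta:
  assumes "x \<in> carrier A" "y \<in> carrier A" "v \<in> carrier V"
  shows "\<mu> (x \<otimes>\<^bsub>A\<^esub> y) v = \<rho> x (\<mu> y v) \<oplus>\<^bsub>V\<^esub> \<mu> y (\<delta> x v)"
proof -
  have "\<mu> (x \<otimes>\<^bsub>A\<^esub> y) v = \<rho> x (\<mu> y v) \<oplus>\<^bsub>V\<^esub> (\<mu> (x \<otimes>\<^bsub>A\<^esub> y) v \<ominus>\<^bsub>V\<^esub> \<rho> x (\<mu> y v))"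
    using assms by algebra
  also have "\<dots> = \<rho> x (\<mu> y v) \<oplus>\<^bsub>V\<^esub> \<mu> y (\<delta> x v)"
    using assms by (simp only: mu_mult) (simp add: \<delta>_def \<mu>.simps)
  finally show ?thesis .
qed

lemma rho_commutator_delta:
  assumes "x \<in> carrier A" "y \<in> carrier A" "v \<in> carrier V"
  shows "\<rho> (commutator A x y) v = \<mu> y (\<delta> x v) \<ominus>\<^bsub>V\<^esub> \<mu> x (\<delta> y v)"
proof -
  \<comment> \<open>Adding and subtracting the two \<open>\<mu>\<close> terms makes the left side of
    \<open>mu_commutator\<close> appear.\<close>
  have "\<rho> (commutator A x y) v = (\<mu> y (\<mu> x v) \<ominus>\<^bsub>V\<^esub> \<mu> x (\<mu> y v) \<oplus>\<^bsub>V\<^esub> \<rho> (commutator A x y) v)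
      \<oplus>\<^bsub>V\<^esub> \<mu> x (\<mu> y v) \<ominus>\<^bsub>V\<^esub> \<mu> y (\<mu> x v)"
    using assms by algebra
  also have "\<dots> = \<mu> y (\<delta> x v) \<ominus>\<^bsub>V\<^esub> \<mu> x (\<delta> y v)"
    using assms by (simp add: mu_commutator \<delta>_def \<mu>.simps) algebra
  finally show ?thesis .
qed

section \<open>The two axioms in a twisted product\<close>

lemma commutator_mult_twisted_product:
  assumes "bilinear_mapping K A A V f"
    and xyz: "x \<in> carrier A" "u \<in> carrier V" "y \<in> carrier A" "v \<in> carrier V"
      "z \<in> carrier A" "w \<in> carrier V"
  shows "commutator (twisted_product f) (x, u) (y, v) \<otimes>\<^bsub>twisted_product f\<^esub> (z, w) =
    (commutator A x y \<otimes>\<^bsub>A\<^esub> z,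
     f (commutator A x y) z \<oplus>\<^bsub>V\<^esub> \<rho> (commutator A x y) w
       \<oplus>\<^bsub>V\<^esub> (\<mu> z (f x y) \<ominus>\<^bsub>V\<^esub> \<mu> z (f y x) \<oplus>\<^bsub>V\<^esub> \<mu> z (\<delta> x v) \<ominus>\<^bsub>V\<^esub> \<mu> z (\<delta> y u)))"
proof -
  interpret f: bilinear_mapping K A A V f by fact
  \<comment> \<open>The commutator of two pairs sees \<open>\<rho>\<close> and \<open>\<mu>\<close>
    only through \<open>\<delta>\<close>.\<close>
  have "f x y \<oplus>\<^bsub>V\<^esub> \<rho> x v \<oplus>\<^bsub>V\<^esub> \<mu> y u \<ominus>\<^bsub>V\<^esub> (f y x \<oplus>\<^bsub>V\<^esub> \<rho> y u \<oplus>\<^bsub>V\<^esub> \<mu> x v)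
      = f x y \<ominus>\<^bsub>V\<^esub> f y x \<oplus>\<^bsub>V\<^esub> \<delta> x v \<ominus>\<^bsub>V\<^esub> \<delta> y u"
    unfolding \<delta>_def using xyz by algebra
  then show ?thesis
    using xyz by (simp add: commutator_twisted_product[OF f.bilinear_mapping_axioms] \<mu>.simps)
qed

text \<open>The first components agree by the axiom in \<open>A\<close>. The difference of the
  second components is the cocycle expression, since \<open>rho_commutator\<close> absorbs the terms
  in \<open>w\<close> and \<open>mu_mult\<close> those in \<open>u\<close> and \<open>v\<close>. The
  right side is free of \<open>u\<close>, \<open>v\<close>, \<open>w\<close>, so the equivalence
  serves both directions of the characterisation of cocycles.\<close>

lemma anti_pre_lie_twisted_product_iff:
  assumes "bilinear_mapping K A A V f"
    and xyz: "x \<in> carrier A" "u \<in> carrier V" "y \<in> carrier A" "v \<in> carrier V"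
      "z \<in> carrier A" "w \<in> carrier V"
  defines "E \<equiv> twisted_product f"
  shows "(x, u) \<otimes>\<^bsub>E\<^esub> ((y, v) \<otimes>\<^bsub>E\<^esub> (z, w)) \<ominus>\<^bsub>E\<^esub> (y, v) \<otimes>\<^bsub>E\<^esub> ((x, u) \<otimes>\<^bsub>E\<^esub> (z, w))
      = commutator E (y, v) (x, u) \<otimes>\<^bsub>E\<^esub> (z, w) \<longleftrightarrow>
    \<rho> x (f y z) \<ominus>\<^bsub>V\<^esub> \<rho> y (f x z) \<ominus>\<^bsub>V\<^esub> \<mu> z (f y x) \<oplus>\<^bsub>V\<^esub> \<mu> z (f x y)
      \<ominus>\<^bsub>V\<^esub> f y (x \<otimes>\<^bsub>A\<^esub> z) \<oplus>\<^bsub>V\<^esub> f x (y \<otimes>\<^bsub>A\<^esub> z) \<oplus>\<^bsub>V\<^esub> f (commutator A x y) z = \<zero>\<^bsub>V\<^esub>"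
    (is "?lhs = ?rhs \<longleftrightarrow> ?c = \<zero>\<^bsub>V\<^esub>")
proof -
  interpret f: bilinear_mapping K A A V f by fact
  \<comment> \<open>The cocycle condition contains the commutator of \<open>x\<close> and
    \<open>y\<close>, the algebra axiom that of \<open>y\<close> and \<open>x\<close>.\<close>
  have neg: "f (commutator A x y) z = \<ominus>\<^bsub>V\<^esub> f (commutator A y x) z"
    using linear_mapping.uminus[OF f.linear_left, of z "commutator A y x"] xyz
    by (simp add: uminus_commutator)
  have rhs: "?rhs = (commutator A y x \<otimes>\<^bsub>A\<^esub> z,
     f (commutator A y x) z \<oplus>\<^bsub>V\<^esub> \<rho> (commutator A y x) w
       \<oplus>\<^bsub>V\<^esub> (\<mu> z (f y x) \<ominus>\<^bsub>V\<^esub> \<mu> z (f x y) \<oplus>\<^bsub>V\<^esub> \<mu> z (\<delta> y u) \<ominus>\<^bsub>V\<^esub> \<mu> z (\<delta> x v)))"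
    unfolding E_def using xyz by (simp add: commutator_mult_twisted_product[OF f.bilinear_mapping_axioms])
  have "snd ?lhs \<ominus>\<^bsub>V\<^esub> snd ?rhs = ?c"
    using xyz unfolding neg rhs
    by (simp add: E_def \<rho>.simps mu_mult_delta rho_commutator[symmetric])
      (rule V.M.anti_pre_lie_cancel; simp)
  moreover have "fst ?lhs = fst ?rhs"
    using xyz unfolding rhs by (simp add: E_def anti_pre_lie)
  moreover have "snd ?lhs \<in> carrier V" "snd ?rhs \<in> carrier V"
    using xyz unfolding rhs by (simp_all add: E_def)
  ultimately show ?thesis
    by (metis V.M.diff_eq_zero_iff prod.collapse)
qed

text \<open>Here the third representation condition enters: \<open>rho_commutator_delta\<close>
  splits each \<open>\<rho>\<close> of a commutator into two mixed terms, and these cancel around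
  the cycle.\<close>

lemma commutator_cyclic_twisted_product_iff:
  assumes "bilinear_mapping K A A V f"
    and xyz: "x \<in> carrier A" "u \<in> carrier V" "y \<in> carrier A" "v \<in> carrier V"
      "z \<in> carrier A" "w \<in> carrier V"
  defines "E \<equiv> twisted_product f"
  shows "commutator E (x, u) (y, v) \<otimes>\<^bsub>E\<^esub> (z, w) \<oplus>\<^bsub>E\<^esub> commutator E (y, v) (z, w) \<otimes>\<^bsub>E\<^esub> (x, u)
      \<oplus>\<^bsub>E\<^esub> commutator E (z, w) (x, u) \<otimes>\<^bsub>E\<^esub> (y, v) = \<zero>\<^bsub>E\<^esub> \<longleftrightarrow>
    \<mu> x (f y z \<ominus>\<^bsub>V\<^esub> f z y) \<oplus>\<^bsub>V\<^esub> \<mu> y (f z x \<ominus>\<^bsub>V\<^esub> f x z) \<oplus>\<^bsub>V\<^esub> \<mu> z (f x y \<ominus>\<^bsub>V\<^esub> f y x)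
      \<oplus>\<^bsub>V\<^esub> f (commutator A x y) z \<oplus>\<^bsub>V\<^esub> f (commutator A y z) x \<oplus>\<^bsub>V\<^esub> f (commutator A z x) y
      = \<zero>\<^bsub>V\<^esub>"
    (is "?lhs = _ \<longleftrightarrow> ?c = \<zero>\<^bsub>V\<^esub>")
proof -
  interpret f: bilinear_mapping K A A V f by fact
  have lhs: "?lhs = (commutator A x y \<otimes>\<^bsub>A\<^esub> z \<oplus>\<^bsub>A\<^esub> commutator A y z \<otimes>\<^bsub>A\<^esub> x \<oplus>\<^bsub>A\<^esub> commutator A z x \<otimes>\<^bsub>A\<^esub> y, ?c)"
    unfolding E_def using xyz
    by (simp add: commutator_mult_twisted_product[OF f.bilinear_mapping_axioms]
        rho_commutator_delta \<mu>.simps)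
      (rule V.M.cyclic_sum_cancel; simp)
  show ?thesis
    unfolding lhs using xyz by (simp add: E_def commutator_cyclic)
qed

lemma anti_pre_lie_algebra_twisted_product_iff:
  assumes f: "bilinear_map K A A V f" "f \<in> carrier A \<rightarrow>\<^sub>E (carrier A \<rightarrow>\<^sub>E carrier V)"
  shows "anti_pre_lie_algebra K (twisted_product f) \<longleftrightarrow> f \<in> cocycles2 K A V \<rho> \<mu>"
proof -
  interpret f: bilinear_mapping K A A V f
    using f by unfold_locales
  show ?thesis
  proof
    assume "anti_pre_lie_algebra K (twisted_product f)"
    then interpret E: anti_pre_lie_algebra K "twisted_product f" .
    show "f \<in> cocycles2 K A V \<rho> \<mu>"
      unfolding cocycles2_def
    proof (intro CollectI conjI ballI f)
      fix x y z assume xyz: "x \<in> carrier A" "y \<in> carrier A" "z \<in> carrier A"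
      \<comment> \<open>The vector components are free, so zero is enough to extract the conditions
        on \<open>f\<close>.\<close>
      note iffs = anti_pre_lie_twisted_product_iff[OF f.bilinear_mapping_axioms,
          of x "\<zero>\<^bsub>V\<^esub>" y "\<zero>\<^bsub>V\<^esub>" z "\<zero>\<^bsub>V\<^esub>"]
        commutator_cyclic_twisted_product_iff[OF f.bilinear_mapping_axioms,
          of x "\<zero>\<^bsub>V\<^esub>" y "\<zero>\<^bsub>V\<^esub>" z "\<zero>\<^bsub>V\<^esub>"]
      show "\<rho> x (f y z) \<ominus>\<^bsub>V\<^esub> \<rho> y (f x z) \<ominus>\<^bsub>V\<^esub> \<mu> z (f y x) \<oplus>\<^bsub>V\<^esub> \<mu> z (f x y)
        \<ominus>\<^bsub>V\<^esub> f y (x \<otimes>\<^bsub>A\<^esub> z) \<oplus>\<^bsub>V\<^esub> f x (y \<otimes>\<^bsub>A\<^esub> z) \<oplus>\<^bsub>V\<^esub> f (commutator A x y) z = \<zero>\<^bsub>V\<^esub>"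
        using xyz by (intro iffs(1)[THEN iffD1] E.anti_pre_lie) simp_all
      show "\<mu> x (f y z \<ominus>\<^bsub>V\<^esub> f z y) \<oplus>\<^bsub>V\<^esub> \<mu> y (f z x \<ominus>\<^bsub>V\<^esub> f x z) \<oplus>\<^bsub>V\<^esub> \<mu> z (f x y \<ominus>\<^bsub>V\<^esub> f y x)
        \<oplus>\<^bsub>V\<^esub> f (commutator A x y) z \<oplus>\<^bsub>V\<^esub> f (commutator A y z) x \<oplus>\<^bsub>V\<^esub> f (commutator A z x) y
        = \<zero>\<^bsub>V\<^esub>"
        using xyz by (intro iffs(2)[THEN iffD1] E.commutator_cyclic) simp_all
    qed
  next
    assume cocycle: "f \<in> cocycles2 K A V \<rho> \<mu>"
    interpret E: module K "twisted_product f"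
      by (rule module_twisted_product)
    show "anti_pre_lie_algebra K (twisted_product f)"
    proof
      show "bilinear_map K (twisted_product f) (twisted_product f) (twisted_product f)
        (mult (twisted_product f))"
        by (rule bilinear_twisted_product) unfold_locales
    next
      fix X Y Z
      assume "X \<in> carrier (twisted_product f)" "Y \<in> carrier (twisted_product f)"
        "Z \<in> carrier (twisted_product f)"
      then obtain x u y v z w where XYZ: "X = (x, u)" "Y = (y, v)" "Z = (z, w)"
        "x \<in> carrier A" "u \<in> carrier V" "y \<in> carrier A" "v \<in> carrier V"
        "z \<in> carrier A" "w \<in> carrier V"
        by auto
      show "X \<otimes>\<^bsub>twisted_product f\<^esub> (Y \<otimes>\<^bsub>twisted_product f\<^esub> Z)
          \<ominus>\<^bsub>twisted_product f\<^esub> Y \<otimes>\<^bsub>twisted_product f\<^esub> (X \<otimes>\<^bsub>twisted_product f\<^esub> Z)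
        = commutator (twisted_product f) Y X \<otimes>\<^bsub>twisted_product f\<^esub> Z"
        using cocycle XYZ(4-) unfolding XYZ(1-3)
        by (subst anti_pre_lie_twisted_product_iff[OF f.bilinear_mapping_axioms])
          (simp_all add: cocycles2_def)
      show "commutator (twisted_product f) X Y \<otimes>\<^bsub>twisted_product f\<^esub> Z
        \<oplus>\<^bsub>twisted_product f\<^esub> commutator (twisted_product f) Y Z \<otimes>\<^bsub>twisted_product f\<^esub> X
        \<oplus>\<^bsub>twisted_product f\<^esub> commutator (twisted_product f) Z X \<otimes>\<^bsub>twisted_product f\<^esub> Y
        = \<zero>\<^bsub>twisted_product f\<^esub>"
        using cocycle XYZ(4-) unfolding XYZ(1-3)
        by (subst commutator_cyclic_twisted_product_iff[OF f.bilinear_mapping_axioms])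
          (simp_all add: cocycles2_def)
    qed
  qed
qed

end

subsection \<open>Complements of subspaces\<close>

text \<open>Zorn's lemma yields a subspace \<open>W\<close> maximal among those meeting
  \<open>N\<close> only in zero. A vector \<open>e\<close> outside the sum of \<open>W\<close> and
  \<open>N\<close> could be adjoined to \<open>W\<close> without meeting \<open>N\<close>, because a
  nonzero coefficient of \<open>e\<close> is invertible in the field.\<close>

lemma subspace_complement:
  fixes K :: "('k, 'm) ring_scheme" and E :: "('k, 'e) module"
  assumes "field K" "module K E" and N: "submodule N K E"
  obtains W where "submodule W K E" "W \<inter> N = {\<zero>\<^bsub>E\<^esub>}"
    "\<And>e. e \<in> carrier E \<Longrightarrow> \<exists>w\<in>W. \<exists>n\<in>N. e = w \<oplus>\<^bsub>E\<^esub> n"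
proof -
  interpret K: field K by fact
  interpret E: module K E by fact
  note subD = E.submoduleE
  have zero_in: "\<zero>\<^bsub>E\<^esub> \<in> W" if "submodule W K E" for W
    using subD(1,2,4)[OF that] E.smult_l_null by (metis K.zero_closed ex_in_conv subsetD)
  let ?\<A> = "{W. submodule W K E \<and> W \<inter> N = {\<zero>\<^bsub>E\<^esub>}}"
  have "\<exists>W\<in>?\<A>. \<forall>X\<in>?\<A>. W \<subseteq> X \<longrightarrow> X = W"
  proof (rule subset_Zorn_nonempty)
    have "submodule {\<zero>\<^bsub>E\<^esub>} K E"
      by (rule E.submoduleI) auto
    then show "?\<A> \<noteq> {}"
      using zero_in[OF N] by blast
  next
    fix C assume C: "C \<noteq> {}" "subset.chain ?\<A> C"
    then have sub: "\<And>W. W \<in> C \<Longrightarrow> submodule W K E" and int: "\<And>W. W \<in> C \<Longrightarrow> W \<inter> N = {\<zero>\<^bsub>E\<^esub>}"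
      and comp: "\<And>W W'. \<lbrakk>W \<in> C; W' \<in> C\<rbrakk> \<Longrightarrow> W \<subseteq> W' \<or> W' \<subseteq> W"
      by (auto simp: subset_chain_def)
    have "submodule (\<Union>C) K E"
    proof (rule E.submoduleI)
      show "\<Union>C \<subseteq> carrier E"
        using subD(1)[OF sub] by blast
      show "\<zero>\<^bsub>E\<^esub> \<in> \<Union>C"
        using C(1) zero_in[OF sub] by (meson UnionI ex_in_conv)
      show "\<ominus>\<^bsub>E\<^esub> a \<in> \<Union>C" if "a \<in> \<Union>C" for a
        using that subD(3)[OF sub] by blast
      show "a \<odot>\<^bsub>E\<^esub> x \<in> \<Union>C" if "a \<in> carrier K" "x \<in> \<Union>C" for a x
        using that subD(4)[OF sub] by blast
      fix a b assume "a \<in> \<Union>C" "b \<in> \<Union>C"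
      then obtain W W' where "W \<in> C" "W' \<in> C" "a \<in> W" "b \<in> W'"
        by blast
      then show "a \<oplus>\<^bsub>E\<^esub> b \<in> \<Union>C"
        using comp[of W W'] subD(5)[OF sub] by blast
    qed
    moreover have "\<Union>C \<inter> N = {\<zero>\<^bsub>E\<^esub>}"
      using C(1) int by blast
    ultimately show "\<Union>C \<in> ?\<A>"
      by blast
  qed
  then obtain W where W_in: "W \<in> ?\<A>" and maximal: "\<forall>X\<in>?\<A>. W \<subseteq> X \<longrightarrow> X = W"
    by (rule bexE)
  have W: "submodule W K E" "W \<inter> N = {\<zero>\<^bsub>E\<^esub>}"
    using W_in by simp_all
  have max: "X = W" if "submodule X K E" "X \<inter> N = {\<zero>\<^bsub>E\<^esub>}" "W \<subseteq> X" for X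
    using maximal that by simp
  have WE: "w \<in> carrier E" if "w \<in> W" for w
    using subD(1)[OF W(1)] that by blast
  have NE: "n \<in> carrier E" if "n \<in> N" for n
    using subD(1)[OF N] that by blast
  have "\<exists>w\<in>W. \<exists>n\<in>N. e = w \<oplus>\<^bsub>E\<^esub> n" if e: "e \<in> carrier E" for e
  proof (rule ccontr)
    assume no: "\<not> ?thesis"
    \<comment> \<open>This is the span of \<open>W\<close> and \<open>e\<close>, the candidate
      contradicting maximality.\<close>
    let ?X = "{w \<oplus>\<^bsub>E\<^esub> a \<odot>\<^bsub>E\<^esub> e | w a. w \<in> W \<and> a \<in> carrier K}"
    have XI: "w \<oplus>\<^bsub>E\<^esub> a \<odot>\<^bsub>E\<^esub> e \<in> ?X" if "w \<in> W" "a \<in> carrier K" for w a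
      using that by blast
    have X: "submodule ?X K E"
    proof (rule E.submoduleI)
      show "?X \<subseteq> carrier E"
        using WE e by auto
      have "\<zero>\<^bsub>E\<^esub> = \<zero>\<^bsub>E\<^esub> \<oplus>\<^bsub>E\<^esub> \<zero>\<^bsub>K\<^esub> \<odot>\<^bsub>E\<^esub> e"
        using e by simp
      then show "\<zero>\<^bsub>E\<^esub> \<in> ?X"
        using zero_in[OF W(1)] by blast
    next
      fix x assume "x \<in> ?X"
      then obtain w a where x: "x = w \<oplus>\<^bsub>E\<^esub> a \<odot>\<^bsub>E\<^esub> e" "w \<in> W" "a \<in> carrier K"
        by blast
      have "\<ominus>\<^bsub>E\<^esub> x = \<ominus>\<^bsub>E\<^esub> w \<oplus>\<^bsub>E\<^esub> (\<ominus>\<^bsub>K\<^esub> a) \<odot>\<^bsub>E\<^esub> e"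
        using x WE e by (simp add: E.M.minus_add E.smult_l_minus)
      then show "\<ominus>\<^bsub>E\<^esub> x \<in> ?X"
        using XI[of "\<ominus>\<^bsub>E\<^esub> w" "\<ominus>\<^bsub>K\<^esub> a"] x subD(3)[OF W(1)] by simp
      fix b assume b: "b \<in> carrier K"
      have "b \<odot>\<^bsub>E\<^esub> x = b \<odot>\<^bsub>E\<^esub> w \<oplus>\<^bsub>E\<^esub> (b \<otimes>\<^bsub>K\<^esub> a) \<odot>\<^bsub>E\<^esub> e"
        using x WE e b by (simp add: E.smult_r_distr E.smult_assoc1)
      then show "b \<odot>\<^bsub>E\<^esub> x \<in> ?X"
        using XI[of "b \<odot>\<^bsub>E\<^esub> w" "b \<otimes>\<^bsub>K\<^esub> a"] x b subD(4)[OF W(1)] by simp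
    next
      fix x y assume "x \<in> ?X" "y \<in> ?X"
      then obtain w a v b where xy: "x = w \<oplus>\<^bsub>E\<^esub> a \<odot>\<^bsub>E\<^esub> e" "w \<in> W" "a \<in> carrier K"
        "y = v \<oplus>\<^bsub>E\<^esub> b \<odot>\<^bsub>E\<^esub> e" "v \<in> W" "b \<in> carrier K"
        by blast
      have "x \<oplus>\<^bsub>E\<^esub> y = (w \<oplus>\<^bsub>E\<^esub> v) \<oplus>\<^bsub>E\<^esub> (a \<oplus>\<^bsub>K\<^esub> b) \<odot>\<^bsub>E\<^esub> e"
        using xy WE e by (simp add: E.smult_l_distr E.M.a_ac)
      then show "x \<oplus>\<^bsub>E\<^esub> y \<in> ?X"
        using XI[of "w \<oplus>\<^bsub>E\<^esub> v" "a \<oplus>\<^bsub>K\<^esub> b"] xy subD(5)[OF W(1)] by simp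
    qed
    have "x = \<zero>\<^bsub>E\<^esub>" if "x \<in> ?X" "x \<in> N" for x
    proof -
      from that obtain w a where x: "x = w \<oplus>\<^bsub>E\<^esub> a \<odot>\<^bsub>E\<^esub> e" "w \<in> W" "a \<in> carrier K"
        by blast
      show ?thesis
      proof (cases "a = \<zero>\<^bsub>K\<^esub>")
        case True
        then have "x = w"
          using x WE e by simp
        then show ?thesis
          using x that W(2) by blast
      next
        case False
        then have a: "a \<in> Units K"
          using x K.field_Units by blast
        let ?b = "inv\<^bsub>K\<^esub> a"
        have b: "?b \<in> carrier K"
          using a by simp
        \<comment> \<open>Dividing by \<open>a\<close> writes \<open>e\<close> as a sum from
          \<open>W\<close> and \<open>N\<close>, which \<open>no\<close> excludes; hence only the
          case of coefficient zero can occur.\<close>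
        have "a \<odot>\<^bsub>E\<^esub> e = \<ominus>\<^bsub>E\<^esub> w \<oplus>\<^bsub>E\<^esub> x"
          using x WE e by (simp add: E.M.r_neg1)
        then have "?b \<odot>\<^bsub>E\<^esub> (a \<odot>\<^bsub>E\<^esub> e) = ?b \<odot>\<^bsub>E\<^esub> (\<ominus>\<^bsub>E\<^esub> w) \<oplus>\<^bsub>E\<^esub> ?b \<odot>\<^bsub>E\<^esub> x"
          using b WE[OF x(2)] NE[OF that(2)] by (simp add: E.smult_r_distr)
        moreover have "?b \<odot>\<^bsub>E\<^esub> (a \<odot>\<^bsub>E\<^esub> e) = e"
          using a b x e by (simp flip: E.smult_assoc1)
        ultimately show ?thesis
          using no b that(2) x(2) subD(3,4)[OF W(1)] subD(4)[OF N] by metis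
      qed
    qed
    then have "?X \<inter> N = {\<zero>\<^bsub>E\<^esub>}"
      using zero_in[OF X] zero_in[OF N] by blast
    moreover have "W \<subseteq> ?X"
      using XI[of _ "\<zero>\<^bsub>K\<^esub>"] e WE by fastforce
    ultimately have "?X = W"
      using max[OF X] by blast
    moreover have "\<zero>\<^bsub>E\<^esub> \<oplus>\<^bsub>E\<^esub> \<one>\<^bsub>K\<^esub> \<odot>\<^bsub>E\<^esub> e \<in> ?X"
      using XI zero_in[OF W(1)] by blast
    ultimately have "e \<in> W"
      using e by simp
    then show False
      using no e zero_in[OF N] by (metis E.M.r_zero)
  qed
  then show ?thesis
    using that W by blast
qed

subsection \<open>Isomorphisms of extensions\<close>

lemma algebra_homD:
  assumes "algebra_hom K A B f"
  shows algebra_hom_linear: "linear_map K A B f"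
    and algebra_hom_mult:
      "\<lbrakk>x \<in> carrier A; y \<in> carrier A\<rbrakk> \<Longrightarrow> f (x \<otimes>\<^bsub>A\<^esub> y) = f x \<otimes>\<^bsub>B\<^esub> f y"
  using assms by (auto simp: algebra_hom_def)

lemma algebra_hom_compose:
  assumes "algebra_hom K A B f" "algebra_hom K B C g"
  shows "algebra_hom K A C (g \<circ> f)"
  using assms by (auto simp: algebra_hom_def linear_map_def hom_def Pi_iff)

text \<open>Only the source is required to satisfy the algebra axioms:
  \<open>transport_algebra\<close> applies this to a target whose axioms are still to be
  proved.\<close>

lemma algebra_hom_the_inv_into:
  assumes A: "anti_pre_lie_algebra K A" and f: "algebra_hom K A B f"
    and bij: "bij_betw f (carrier A) (carrier B)"
  shows "algebra_hom K B A (the_inv_into (carrier A) f)"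
proof -
  interpret A: anti_pre_lie_algebra K A by fact
  note f = linear_mapD[OF algebra_hom_linear[OF f]] algebra_hom_mult[OF f]
  note inj = bij_betw_imp_inj_on[OF bij]
  have inv: "x \<in> carrier B \<Longrightarrow> the_inv_into (carrier A) f x \<in> carrier A"
    "x \<in> carrier B \<Longrightarrow> f (the_inv_into (carrier A) f x) = x" for x
    using bij by (auto simp: bij_betw_def intro: the_inv_into_into f_the_inv_into_f)
  show ?thesis
    unfolding algebra_hom_def
    by (intro conjI ballI linear_mapI) (auto intro!: the_inv_into_f_eq[OF inj] simp: inv f)
qed

lemma extension_isomorphic_refl: "extension_isomorphic K V X X"
proof -
  obtain E \<iota> p where X: "X = (E, \<iota>, p)"
    using prod_cases3 by blast
  show ?thesis
    unfolding X extension_isomorphic_def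
    by (auto intro!: exI[of _ id] simp: algebra_hom_def linear_map_def hom_def)
qed

lemma extension_isomorphic_trans:
  assumes "extension_isomorphic K V X Y" "extension_isomorphic K V Y Z"
  shows "extension_isomorphic K V X Z"
proof -
  obtain E1 \<iota>1 p1 E2 \<iota>2 p2 E3 \<iota>3 p3 where XYZ: "X = (E1, \<iota>1, p1)" "Y = (E2, \<iota>2, p2)"
    "Z = (E3, \<iota>3, p3)"
    using prod_cases3 by metis
  obtain f g where "algebra_hom K E1 E2 f" "bij_betw f (carrier E1) (carrier E2)"
    "\<forall>u\<in>carrier V. f (\<iota>1 u) = \<iota>2 u" "\<forall>e\<in>carrier E1. p2 (f e) = p1 e"
    and "algebra_hom K E2 E3 g" "bij_betw g (carrier E2) (carrier E3)"
    "\<forall>u\<in>carrier V. g (\<iota>2 u) = \<iota>3 u" "\<forall>e\<in>carrier E2. p3 (g e) = p2 e"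
    using assms unfolding XYZ extension_isomorphic_def by auto
  then show ?thesis
    unfolding XYZ extension_isomorphic_def
    by (auto intro!: exI[of _ "g \<circ> f"] algebra_hom_compose bij_betw_trans
        simp: bij_betw_apply)
qed

lemma extension_isomorphic_sym:
  assumes X: "abelian_extension K A V X" and XY: "extension_isomorphic K V X Y"
  shows "extension_isomorphic K V Y X"
proof -
  obtain E1 \<iota>1 p1 E2 \<iota>2 p2 where XY': "X = (E1, \<iota>1, p1)" "Y = (E2, \<iota>2, p2)"
    using prod_cases3 by metis
  obtain f where f: "algebra_hom K E1 E2 f" "bij_betw f (carrier E1) (carrier E2)"
    "\<forall>u\<in>carrier V. f (\<iota>1 u) = \<iota>2 u" "\<forall>e\<in>carrier E1. p2 (f e) = p1 e"
    using XY unfolding XY' extension_isomorphic_def by auto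
  have E1: "anti_pre_lie_algebra K E1" and \<iota>1: "linear_map K (zero_product V) E1 \<iota>1"
    using X by (auto simp: XY' abelian_extension_def algebra_hom_def)
  note inj = bij_betw_imp_inj_on[OF f(2)]
  have "\<iota>1 u \<in> carrier E1" if "u \<in> carrier V" for u
    using linear_map_closed[OF \<iota>1] that by (simp add: zero_product_def)
  then have "the_inv_into (carrier E1) f (\<iota>2 u) = \<iota>1 u" if "u \<in> carrier V" for u
    using f(3) that the_inv_into_f_f[OF inj] by metis
  moreover have "p1 (the_inv_into (carrier E1) f e) = p2 e" if "e \<in> carrier E2" for e
    using f(2,4) that
    by (metis bij_betw_def f_the_inv_into_f subset_refl the_inv_into_into)
  ultimately show ?thesis
    unfolding XY' extension_isomorphic_def
    using algebra_hom_the_inv_into[OF E1 f(1,2)] bij_betw_the_inv_into[OF f(2)] by auto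
qed

text \<open>An identity may be tested after applying the injective \<open>h\<close>, provided both
  sides lie in \<open>carrier C\<close>; hence the closure assumption. It is applied to twisted
  products and to transported algebras.\<close>

lemma anti_pre_lie_algebra_pullback:
  assumes "anti_pre_lie_algebra K E" and "module K C"
    and h: "algebra_hom K C E h" "inj_on h (carrier C)"
    and closed: "\<And>x y. \<lbrakk>x \<in> carrier C; y \<in> carrier C\<rbrakk> \<Longrightarrow> x \<otimes>\<^bsub>C\<^esub> y \<in> carrier C"
  shows "anti_pre_lie_algebra K C"
proof -
  interpret E: anti_pre_lie_algebra K E by fact
  interpret C: module K C by fact
  interpret h: linear_mapping K C E h
    using algebra_hom_linear[OF h(1)] by unfold_locales
  note mult = algebra_hom_mult[OF h(1)]
  note simps = h.simps mult E.mult.simps closed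
  have commutator: "commutator C x y \<in> carrier C"
    "h (commutator C x y) = commutator E (h x) (h y)"
    if "x \<in> carrier C" "y \<in> carrier C" for x y
    using that by (simp_all add: commutator_def simps)
  show ?thesis
  proof
    show "bilinear_map K C C C (mult C)"
      by (rule bilinear_mapI) (auto intro!: inj_onD[OF h(2)] simp: simps)
  qed (auto intro!: inj_onD[OF h(2)] E.anti_pre_lie E.commutator_cyclic simp: simps commutator)
qed

section \<open>Transport of structure\<close>

definition transport_algebra :: "('e \<Rightarrow> 'f) \<Rightarrow> ('k, 'e) module \<Rightarrow> ('k, 'f) module" where
  "transport_algebra j E = (let g = the_inv_into (carrier E) j in
     \<lparr>carrier = j ` carrier E,
      mult = (\<lambda>x y. j (g x \<otimes>\<^bsub>E\<^esub> g y)),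
      one = undefined,
      zero = j \<zero>\<^bsub>E\<^esub>,
      add = (\<lambda>x y. j (g x \<oplus>\<^bsub>E\<^esub> g y)),
      smult = (\<lambda>a x. j (a \<odot>\<^bsub>E\<^esub> g x))\<rparr>)"

text \<open>This moves a twisted product from pairs to the type of the given extensions. The module
  laws are checked directly, since they are needed before the remaining axioms can be pulled back
  along the inverse of \<open>j\<close>.\<close>

lemma transport_algebra:
  assumes "anti_pre_lie_algebra K E" and j: "inj_on j (carrier E)"
  shows "anti_pre_lie_algebra K (transport_algebra j E)"
    and "algebra_hom K E (transport_algebra j E) j"
    and "bij_betw j (carrier E) (carrier (transport_algebra j E))"
proof -
  interpret E: anti_pre_lie_algebra K E by fact
  let ?C = "transport_algebra j E"
  have carrier: "carrier ?C = j ` carrier E"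
    by (simp add: transport_algebra_def Let_def)
  have ops: "j x \<otimes>\<^bsub>?C\<^esub> j y = j (x \<otimes>\<^bsub>E\<^esub> y)" "j x \<oplus>\<^bsub>?C\<^esub> j y = j (x \<oplus>\<^bsub>E\<^esub> y)"
    "a \<odot>\<^bsub>?C\<^esub> j x = j (a \<odot>\<^bsub>E\<^esub> x)" "\<zero>\<^bsub>?C\<^esub> = j \<zero>\<^bsub>E\<^esub>"
    if "x \<in> carrier E" "y \<in> carrier E" for x y a
    using that by (simp_all add: transport_algebra_def Let_def the_inv_into_f_f[OF j])
  have zero: "\<zero>\<^bsub>?C\<^esub> = j \<zero>\<^bsub>E\<^esub>"
    by (simp add: transport_algebra_def Let_def)
  show hom: "algebra_hom K E ?C j"
    unfolding algebra_hom_def by (intro conjI ballI linear_mapI) (simp_all add: carrier ops)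
  show bij: "bij_betw j (carrier E) (carrier ?C)"
    using j by (simp add: bij_betw_def carrier)
  have "abelian_group ?C"
  proof (rule abelian_groupI)
    fix x assume "x \<in> carrier ?C"
    then obtain y where "x = j y" "y \<in> carrier E"
      by (auto simp: carrier)
    then show "\<exists>y\<in>carrier ?C. y \<oplus>\<^bsub>?C\<^esub> x = \<zero>\<^bsub>?C\<^esub>"
      by (intro bexI[of _ "j (\<ominus>\<^bsub>E\<^esub> y)"]) (simp_all add: carrier ops zero E.M.l_neg)
  qed (auto simp: carrier ops zero E.M.a_ac)
  then have module: "module K ?C"
    by (intro moduleI)
      (auto simp: carrier ops zero E.smult_l_distr E.smult_r_distr E.smult_assoc1 E.K.is_cring)
  have closed: "x \<otimes>\<^bsub>?C\<^esub> y \<in> carrier ?C" if "x \<in> carrier ?C" "y \<in> carrier ?C" for x y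
    using that by (auto simp: carrier ops)
  have "algebra_hom K ?C E (the_inv_into (carrier E) j)"
    by (rule algebra_hom_the_inv_into[OF assms(1) hom bij])
  moreover have "inj_on (the_inv_into (carrier E) j) (carrier ?C)"
    using bij_betw_the_inv_into[OF bij] by (rule bij_betw_imp_inj_on)
  ultimately show "anti_pre_lie_algebra K ?C"
    using anti_pre_lie_algebra_pullback[OF assms(1) module] closed by blast
qed

subsection \<open>Abelian extensions\<close>

locale anti_pre_lie_extension = anti_pre_lie_representation K A V \<rho> \<mu>
  for K :: "('k, 'm) ring_scheme" (structure) and A :: "('k, 'a) module" (structure)
    and V :: "('k, 'v) module" (structure) and \<rho> \<mu> +
  fixes E :: "('k, 'e) module" and \<iota> :: "'v \<Rightarrow> 'e" and p :: "'e \<Rightarrow> 'a"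
  assumes extension: "(E, \<iota>, p) \<in> extensions K A V \<rho> \<mu>"
begin

lemma abelian: "abelian_extension K A V (E, \<iota>, p)"
  using extension by (simp add: extensions_def)

sublocale E: anti_pre_lie_algebra K E
  using abelian by (simp add: abelian_extension_def)

sublocale \<iota>: linear_mapping K V E \<iota>
  using abelian by unfold_locales
    (simp add: abelian_extension_def algebra_hom_def linear_map_def hom_def zero_product_def)

sublocale p: linear_mapping K E A p
  using abelian by unfold_locales
    (simp add: abelian_extension_def algebra_hom_def linear_map_def hom_def)

lemma p_mult: "\<lbrakk>x \<in> carrier E; y \<in> carrier E\<rbrakk> \<Longrightarrow> p (x \<otimes>\<^bsub>E\<^esub> y) = p x \<otimes>\<^bsub>A\<^esub> p y"
  using abelian by (simp add: abelian_extension_def algebra_hom_def)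

lemma iota_mult:
  assumes "u \<in> carrier V" "v \<in> carrier V"
  shows "\<iota> u \<otimes>\<^bsub>E\<^esub> \<iota> v = \<zero>\<^bsub>E\<^esub>"
proof -
  have "\<iota> (u \<otimes>\<^bsub>zero_product V\<^esub> v) = \<iota> u \<otimes>\<^bsub>E\<^esub> \<iota> v"
    using abelian assms
    by (intro algebra_hom_mult[where K = K]) (simp_all add: abelian_extension_def zero_product_def)
  then show ?thesis
    by (simp add: zero_product_def \<iota>.zero)
qed

lemma inj_iota: "inj_on \<iota> (carrier V)"
  using abelian by (simp add: abelian_extension_def)

lemma iota_eq_iff: "\<lbrakk>u \<in> carrier V; v \<in> carrier V\<rbrakk> \<Longrightarrow> \<iota> u = \<iota> v \<longleftrightarrow> u = v"
  using inj_iota by (simp add: inj_on_eq_iff)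

lemma image_iota: "\<iota> ` carrier V = {e \<in> carrier E. p e = \<zero>\<^bsub>A\<^esub>}"
  using abelian by (simp add: abelian_extension_def a_kernel_def kernel_def)

lemma p_iota [simp]: "u \<in> carrier V \<Longrightarrow> p (\<iota> u) = \<zero>\<^bsub>A\<^esub>"
  using image_iota by blast

lemma kernelE:
  assumes "e \<in> carrier E" "p e = \<zero>\<^bsub>A\<^esub>"
  obtains u where "u \<in> carrier V" "e = \<iota> u"
  using assms image_iota by blast

lemma p_surj: "p ` carrier E = carrier A"
  using abelian by (simp add: abelian_extension_def)

text \<open>On a complement \<open>W\<close> of the kernel, \<open>p\<close> is a linear bijection
  onto \<open>A\<close>; the section is its inverse.\<close>

lemma section_exists: "\<exists>s. extension_section K A (E, \<iota>, p) s"
proof -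
  have "submodule (\<iota> ` carrier V) K E"
    by (rule E.submoduleI) (auto simp: image_iota p.simps)
  then obtain W where W: "submodule W K E" "W \<inter> \<iota> ` carrier V = {\<zero>\<^bsub>E\<^esub>}"
    and sum: "\<And>e. e \<in> carrier E \<Longrightarrow> \<exists>w\<in>W. \<exists>n\<in>\<iota> ` carrier V. e = w \<oplus>\<^bsub>E\<^esub> n"
    using subspace_complement[of K E "\<iota> ` carrier V"] A.K.field_axioms E.module_axioms by metis
  note sub = E.submoduleE[OF W(1)]
  have WE: "w \<in> carrier E" if "w \<in> W" for w
    using sub(1) that by blast
  \<comment> \<open>Uniqueness of the preimage in \<open>W\<close> is also what makes the chosen
    \<open>s\<close> linear.\<close>
  have inj: "w = w'" if "w \<in> W" "w' \<in> W" "p w = p w'" for w w'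
  proof -
    have "w \<ominus>\<^bsub>E\<^esub> w' \<in> W"
      using sub(3,5) that by (simp add: a_minus_def)
    moreover have "p (w \<ominus>\<^bsub>E\<^esub> w') = \<zero>\<^bsub>A\<^esub>"
      using that WE by (simp add: p.diff A.M.diff_eq_zero_iff)
    ultimately have "w \<ominus>\<^bsub>E\<^esub> w' = \<zero>\<^bsub>E\<^esub>"
      using W(2) WE image_iota by blast
    then show ?thesis
      using that WE by (simp add: E.M.diff_eq_zero_iff)
  qed
  have surj: "\<exists>w. w \<in> W \<and> p w = x" if "x \<in> carrier A" for x
  proof -
    obtain e where "e \<in> carrier E" "x = p e"
      using \<open>x \<in> carrier A\<close> p_surj by blast
    moreover then obtain w u where "w \<in> W" "u \<in> carrier V" "e = w \<oplus>\<^bsub>E\<^esub> \<iota> u"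
      using sum by blast
    ultimately show ?thesis
      using WE by (intro exI[of _ w]) (simp add: p.additive)
  qed
  define s where "s x = (SOME w. w \<in> W \<and> p w = x)" for x
  have s: "s x \<in> W" "p (s x) = x" if "x \<in> carrier A" for x
    using someI_ex[OF surj[OF that]] by (simp_all add: s_def)
  have "linear_map K A E s"
  proof (rule linear_mapI)
    show "s x \<in> carrier E" if "x \<in> carrier A" for x
      using s that WE by blast
    show "s (x \<oplus>\<^bsub>A\<^esub> y) = s x \<oplus>\<^bsub>E\<^esub> s y" if "x \<in> carrier A" "y \<in> carrier A" for x y
      using s that WE sub(5) by (intro inj) (simp_all add: p.simps)
    show "s (a \<odot>\<^bsub>A\<^esub> x) = a \<odot>\<^bsub>E\<^esub> s x" if "a \<in> carrier K" "x \<in> carrier A" for a x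
      using s that WE sub(4) by (intro inj) (simp_all add: p.simps)
  qed
  then show ?thesis
    using s by (auto simp: extension_section_def)
qed

text \<open>The maps of the new extension are forced by requiring \<open>\<zeta>\<close> to be an
  isomorphism of extensions.\<close>

lemma extensions_transport:
  fixes F :: "('k, 'f) module"
  assumes F: "anti_pre_lie_algebra K F" and \<zeta>: "algebra_hom K E F \<zeta>"
    and bij: "bij_betw \<zeta> (carrier E) (carrier F)"
  defines "\<xi> \<equiv> the_inv_into (carrier E) \<zeta>"
  shows "(F, \<zeta> \<circ> \<iota>, p \<circ> \<xi>) \<in> extensions K A V \<rho> \<mu>"
    and "extension_isomorphic K V (E, \<iota>, p) (F, \<zeta> \<circ> \<iota>, p \<circ> \<xi>)"
proof -
  interpret F: anti_pre_lie_algebra K F by fact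
  note inj = bij_betw_imp_inj_on[OF bij]
  have \<xi>: "algebra_hom K F E \<xi>"
    unfolding \<xi>_def by (rule algebra_hom_the_inv_into[OF E.anti_pre_lie_algebra_axioms \<zeta> bij])
  note \<xi>_hom = linear_mapD[OF algebra_hom_linear[OF \<xi>]] algebra_hom_mult[OF \<xi>]
  note \<zeta>_hom = linear_mapD[OF algebra_hom_linear[OF \<zeta>]] algebra_hom_mult[OF \<zeta>]
  interpret \<zeta>: linear_mapping K E F \<zeta>
    using algebra_hom_linear[OF \<zeta>] by unfold_locales
  have \<xi>_\<zeta>: "\<xi> (\<zeta> e) = e" if "e \<in> carrier E" for e
    using that by (simp add: \<xi>_def the_inv_into_f_f[OF inj])
  have \<zeta>_\<xi>: "\<zeta> (\<xi> e) = e" if "e \<in> carrier F" for e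
    using that bij by (simp add: \<xi>_def f_the_inv_into_f_bij_betw)
  have "\<xi> ` carrier F = carrier E"
    unfolding \<xi>_def using bij_betw_the_inv_into[OF bij] by (simp add: bij_betw_def)
  then have surj: "(p \<circ> \<xi>) ` carrier F = carrier A"
    by (metis image_comp p_surj)
  have \<iota>_hom: "algebra_hom K (zero_product V) E \<iota>" and p_hom: "algebra_hom K E A p"
    using abelian by (simp_all add: abelian_extension_def)
  have "(\<zeta> \<circ> \<iota>) ` carrier V = a_kernel F A (p \<circ> \<xi>)"
  proof -
    have "(\<zeta> \<circ> \<iota>) ` carrier V = \<zeta> ` {e \<in> carrier E. p e = \<zero>\<^bsub>A\<^esub>}"
      by (metis image_comp image_iota)
    also have "\<dots> = {e \<in> carrier F. p (\<xi> e) = \<zero>\<^bsub>A\<^esub>}"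
      using \<xi>_\<zeta> \<zeta>_\<xi> \<xi>_hom(1) by (force simp: image_iff)
    finally show ?thesis
      by (simp add: a_kernel_def kernel_def)
  qed
  moreover have "inj_on (\<zeta> \<circ> \<iota>) (carrier V)"
    by (rule comp_inj_on[OF inj_iota inj_on_subset[OF inj]]) (auto simp: image_iota)
  ultimately have "abelian_extension K A V (F, \<zeta> \<circ> \<iota>, p \<circ> \<xi>)"
    using F surj algebra_hom_compose[OF \<iota>_hom \<zeta>] algebra_hom_compose[OF \<xi> p_hom]
    by (simp add: abelian_extension_def)
  moreover have "induces_representation K A V \<rho> \<mu> (F, \<zeta> \<circ> \<iota>, p \<circ> \<xi>)"
    unfolding induces_representation_def split_def fst_conv snd_conv
  proof (intro allI impI ballI)
    fix t x u
    assume "extension_section K A (F, \<zeta> \<circ> \<iota>, p \<circ> \<xi>) t" and xu: "x \<in> carrier A" "u \<in> carrier V"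
    then have t: "linear_map K A F t" "\<And>x. x \<in> carrier A \<Longrightarrow> p (\<xi> (t x)) = x"
      by (simp_all add: extension_section_def)
    \<comment> \<open>The induced representation is a condition on every section, so an arbitrary
      section of \<open>F\<close> is carried back to \<open>E\<close>, where the condition is
      known.\<close>
    have "extension_section K A (E, \<iota>, p) (\<xi> \<circ> t)"
      using t \<xi>_hom by (auto simp: extension_section_def linear_map_closed linear_map_add
          linear_map_smult intro!: linear_mapI)
    then have "\<iota> (\<rho> x u) = \<xi> (t x) \<otimes>\<^bsub>E\<^esub> \<iota> u" "\<iota> (\<mu> x u) = \<iota> u \<otimes>\<^bsub>E\<^esub> \<xi> (t x)"
      using extension xu by (auto simp: extensions_def induces_representation_def)
    then show "(\<zeta> \<circ> \<iota>) (\<rho> x u) = t x \<otimes>\<^bsub>F\<^esub> (\<zeta> \<circ> \<iota>) u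
        \<and> (\<zeta> \<circ> \<iota>) (\<mu> x u) = (\<zeta> \<circ> \<iota>) u \<otimes>\<^bsub>F\<^esub> t x"
      using xu \<zeta>_\<xi> \<xi>_hom(1) \<zeta>_hom(4) linear_map_closed[OF t(1)] by simp
  qed
  ultimately show "(F, \<zeta> \<circ> \<iota>, p \<circ> \<xi>) \<in> extensions K A V \<rho> \<mu>"
    by (simp add: extensions_def)
  show "extension_isomorphic K V (E, \<iota>, p) (F, \<zeta> \<circ> \<iota>, p \<circ> \<xi>)"
    using \<zeta> bij \<xi>_\<zeta> by (auto simp: extension_isomorphic_def)
qed

end

subsection \<open>Sections and their cocycles\<close>

locale anti_pre_lie_extension_section = anti_pre_lie_extension K A V \<rho> \<mu> E \<iota> p
  for K :: "('k, 'm) ring_scheme" (structure) and A :: "('k, 'a) module" (structure)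
    and V :: "('k, 'v) module" (structure) and \<rho> \<mu>
    and E :: "('k, 'e) module" and \<iota> p +
  fixes s :: "'a \<Rightarrow> 'e"
  assumes is_section: "extension_section K A (E, \<iota>, p) s"
begin

sublocale s: linear_mapping K A E s
  using is_section by unfold_locales (simp add: extension_section_def)

lemma p_section [simp]: "x \<in> carrier A \<Longrightarrow> p (s x) = x"
  using is_section by (simp add: extension_section_def)

lemma iota_rho: "\<lbrakk>x \<in> carrier A; u \<in> carrier V\<rbrakk> \<Longrightarrow> \<iota> (\<rho> x u) = s x \<otimes>\<^bsub>E\<^esub> \<iota> u"
  and iota_mu: "\<lbrakk>x \<in> carrier A; u \<in> carrier V\<rbrakk> \<Longrightarrow> \<iota> (\<mu> x u) = \<iota> u \<otimes>\<^bsub>E\<^esub> s x"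
  using extension is_section by (auto simp: extensions_def induces_representation_def)

definition \<theta> where "\<theta> = extension_cocycle A V (E, \<iota>, p) s"

lemma theta_extensional: "\<theta> \<in> extensional (carrier A)"
  by (simp add: \<theta>_def extension_cocycle_def)

lemma theta:
  assumes "x \<in> carrier A" "y \<in> carrier A"
  shows theta_closed [simp]: "\<theta> x y \<in> carrier V"
    and iota_theta: "\<iota> (\<theta> x y) = s x \<otimes>\<^bsub>E\<^esub> s y \<ominus>\<^bsub>E\<^esub> s (x \<otimes>\<^bsub>A\<^esub> y)"
proof -
  have "p (s x \<otimes>\<^bsub>E\<^esub> s y \<ominus>\<^bsub>E\<^esub> s (x \<otimes>\<^bsub>A\<^esub> y)) = \<zero>\<^bsub>A\<^esub>"
    using assms by (simp add: p.simps p_mult A.M.diff_eq_zero_iff)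
  then have "s x \<otimes>\<^bsub>E\<^esub> s y \<ominus>\<^bsub>E\<^esub> s (x \<otimes>\<^bsub>A\<^esub> y) \<in> \<iota> ` carrier V"
    using assms by (simp add: image_iota)
  then show "\<theta> x y \<in> carrier V" "\<iota> (\<theta> x y) = s x \<otimes>\<^bsub>E\<^esub> s y \<ominus>\<^bsub>E\<^esub> s (x \<otimes>\<^bsub>A\<^esub> y)"
    using assms
    by (simp_all add: \<theta>_def extension_cocycle_def f_the_inv_into_f[OF inj_iota]
        the_inv_into_into[OF inj_iota _ subset_refl])
qed

text \<open>Injectivity of \<open>\<iota>\<close> reduces every computation of a cocycle value to
  one in \<open>E\<close>.\<close>

lemma thetaI:
  assumes "x \<in> carrier A" "y \<in> carrier A" "v \<in> carrier V"
    and "\<iota> v = s x \<otimes>\<^bsub>E\<^esub> s y \<ominus>\<^bsub>E\<^esub> s (x \<otimes>\<^bsub>A\<^esub> y)"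
  shows "\<theta> x y = v"
  using assms iota_theta[of x y] iota_eq_iff[of "\<theta> x y" v] by simp

lemma section_mult:
  assumes "x \<in> carrier A" "y \<in> carrier A"
  shows "s x \<otimes>\<^bsub>E\<^esub> s y = s (x \<otimes>\<^bsub>A\<^esub> y) \<oplus>\<^bsub>E\<^esub> \<iota> (\<theta> x y)"
  using assms by (simp add: iota_theta E.M.add_diff_cancel)

text \<open>After applying the injective \<open>\<iota>\<close>, this is bilinearity of the defect
  in \<open>E\<close>. It must come first, as the characterisation of cocycles by twisted products
  presupposes a bilinear map.\<close>

lemma bilinear_theta: "bilinear_map K A A V \<theta>"
proof -
  have smult_diff: "a \<odot>\<^bsub>E\<^esub> (x \<ominus>\<^bsub>E\<^esub> y) = a \<odot>\<^bsub>E\<^esub> x \<ominus>\<^bsub>E\<^esub> a \<odot>\<^bsub>E\<^esub> y"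
    if "a \<in> carrier K" "x \<in> carrier E" "y \<in> carrier E" for a x y
    using that by (simp add: a_minus_def E.smult_r_distr E.smult_r_minus)
  have add_diff: "(x \<oplus>\<^bsub>E\<^esub> y) \<ominus>\<^bsub>E\<^esub> (z \<oplus>\<^bsub>E\<^esub> w) = (x \<ominus>\<^bsub>E\<^esub> z) \<oplus>\<^bsub>E\<^esub> (y \<ominus>\<^bsub>E\<^esub> w)"
    if "x \<in> carrier E" "y \<in> carrier E" "z \<in> carrier E" "w \<in> carrier E" for x y z w
    using that by (simp add: a_minus_def E.M.minus_add E.M.a_ac)
  show ?thesis
    by (rule bilinear_mapI)
      (auto intro!: inj_onD[OF inj_iota] simp: iota_theta \<iota>.simps s.simps mult.simps E.mult.simps
        smult_diff add_diff)
qed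

section \<open>Extensions as twisted products\<close>

definition h :: "'a \<times> 'v \<Rightarrow> 'e" where
  "h = (\<lambda>(x, u). s x \<oplus>\<^bsub>E\<^esub> \<iota> u)"

lemma h_simp [simp]: "h (x, u) = s x \<oplus>\<^bsub>E\<^esub> \<iota> u"
  by (simp add: h_def)

text \<open>In the product of \<open>s x \<oplus> \<iota> u\<close> and
  \<open>s y \<oplus> \<iota> v\<close>, the two section values contribute
  \<open>\<theta> x y\<close>, the mixed products give \<open>\<rho> x v\<close> and
  \<open>\<mu> y u\<close>, and the product of two elements of \<open>V\<close> vanishes.
  Bijectivity is the unique decomposition of \<open>e\<close> into \<open>s (p e)\<close> and an
  element of the kernel of \<open>p\<close>.\<close>

lemma twisted_product_iso:
  shows "algebra_hom K (twisted_product \<theta>) E h"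
    and "bij_betw h (carrier (twisted_product \<theta>)) (carrier E)"
proof -
  show "algebra_hom K (twisted_product \<theta>) E h"
    unfolding algebra_hom_def
  proof (intro conjI ballI linear_mapI)
    fix X Y assume "X \<in> carrier (twisted_product \<theta>)" "Y \<in> carrier (twisted_product \<theta>)"
    then obtain x u y v where XY: "X = (x, u)" "Y = (y, v)" "x \<in> carrier A" "u \<in> carrier V"
      "y \<in> carrier A" "v \<in> carrier V"
      by auto
    then show "h (X \<otimes>\<^bsub>twisted_product \<theta>\<^esub> Y) = h X \<otimes>\<^bsub>E\<^esub> h Y"
      by (simp add: \<iota>.simps E.mult.simps section_mult iota_mult iota_rho iota_mu E.M.a_ac)
  qed (auto simp: s.simps \<iota>.simps E.smult_r_distr E.M.a_ac)
  show "bij_betw h (carrier (twisted_product \<theta>)) (carrier E)"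
    unfolding bij_betw_def
  proof
    show "inj_on h (carrier (twisted_product \<theta>))"
    proof (rule inj_onI)
      fix X Y assume "X \<in> carrier (twisted_product \<theta>)" "Y \<in> carrier (twisted_product \<theta>)"
        and eq: "h X = h Y"
      then obtain x u y v where XY: "X = (x, u)" "Y = (y, v)" "x \<in> carrier A" "u \<in> carrier V"
        "y \<in> carrier A" "v \<in> carrier V"
        by auto
      have "p (h X) = p (h Y)"
        by (simp add: eq)
      then have "x = y"
        using XY by (simp add: p.simps)
      then show "X = Y"
        using eq XY by (simp add: iota_eq_iff)
    qed
    show "h ` carrier (twisted_product \<theta>) = carrier E"
    proof
      show "h ` carrier (twisted_product \<theta>) \<subseteq> carrier E"
        by auto
      show "carrier E \<subseteq> h ` carrier (twisted_product \<theta>)"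
      proof
        fix e assume e: "e \<in> carrier E"
        then have "p (e \<ominus>\<^bsub>E\<^esub> s (p e)) = \<zero>\<^bsub>A\<^esub>"
          by (simp add: p.simps A.M.diff_eq_zero_iff)
        then obtain u where u: "u \<in> carrier V" "e \<ominus>\<^bsub>E\<^esub> s (p e) = \<iota> u"
          using e kernelE[of "e \<ominus>\<^bsub>E\<^esub> s (p e)"] by auto
        have "e = h (p e, u)"
          using e by (simp add: E.M.add_diff_cancel flip: u(2))
        then show "e \<in> h ` carrier (twisted_product \<theta>)"
          by (rule image_eqI) (use e u(1) in simp)
      qed
    qed
  qed
qed

lemma theta_PiE: "\<theta> \<in> carrier A \<rightarrow>\<^sub>E (carrier A \<rightarrow>\<^sub>E carrier V)"
proof (rule PiE_I)
  fix x assume x: "x \<in> carrier A"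
  then have "\<theta> x \<in> extensional (carrier A)"
    by (simp add: \<theta>_def extension_cocycle_def)
  then show "\<theta> x \<in> carrier A \<rightarrow>\<^sub>E carrier V"
    using x by (auto intro: PiE_I simp: extensional_def)
qed (use theta_extensional in \<open>simp add: extensional_def\<close>)

lemma theta_cocycle: "\<theta> \<in> cocycles2 K A V \<rho> \<mu>"
proof -
  have "anti_pre_lie_algebra K (twisted_product \<theta>)"
    by (rule anti_pre_lie_algebra_pullback[OF E.anti_pre_lie_algebra_axioms module_twisted_product
          twisted_product_iso(1) bij_betw_imp_inj_on[OF twisted_product_iso(2)]])
      auto
  then show ?thesis
    using anti_pre_lie_algebra_twisted_product_iff[OF bilinear_theta theta_PiE] by simp
qed

lemma extension_isomorphic_twisted_product:
  "extension_isomorphic K V (twisted_product \<theta>, \<lambda>u. (\<zero>\<^bsub>A\<^esub>, u), fst) (E, \<iota>, p)"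
proof -
  have "\<forall>e\<in>carrier (twisted_product \<theta>). p (h e) = fst e"
    by (auto simp: p.simps)
  moreover have "\<forall>u\<in>carrier V. h (\<zero>\<^bsub>A\<^esub>, u) = \<iota> u"
    by (simp add: s.zero)
  ultimately show ?thesis
    unfolding extension_isomorphic_def split_conv
    by (intro exI[of _ h] conjI twisted_product_iso)
qed

text \<open>The mixed products of \<open>s\<close> with \<open>\<iota> \<circ> \<phi>\<close> give
  the terms with \<open>\<rho>\<close> and \<open>\<mu>\<close>, the value of \<open>t\<close> at
  the product gives the subtracted one. Read backwards, every cocycle cohomologous to
  \<open>\<theta>\<close> belongs to some section of the same extension.\<close>

lemma section_add_cochain:
  assumes \<phi>: "linear_map K A V \<phi>"
  defines "t \<equiv> \<lambda>x. s x \<oplus>\<^bsub>E\<^esub> \<iota> (\<phi> x)"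
  shows "extension_section K A (E, \<iota>, p) t"
    and "extension_cocycle A V (E, \<iota>, p) t =
      (\<lambda>x\<in>carrier A. \<lambda>y\<in>carrier A. coboundary1 A V \<rho> \<mu> \<phi> x y \<oplus>\<^bsub>V\<^esub> \<theta> x y)"
proof -
  interpret \<phi>: linear_mapping K A V \<phi>
    using \<phi> by unfold_locales
  show t_section: "extension_section K A (E, \<iota>, p) t"
    unfolding extension_section_def split_conv
  proof (intro conjI ballI linear_mapI)
  qed (simp_all add: t_def s.simps \<iota>.simps \<phi>.simps p.simps E.smult_r_distr E.M.a_ac)
  interpret t: anti_pre_lie_extension_section K A V \<rho> \<mu> E \<iota> p t
    using t_section by unfold_locales
  have "t.\<theta> x y = coboundary1 A V \<rho> \<mu> \<phi> x y \<oplus>\<^bsub>V\<^esub> \<theta> x y"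
    if xy: "x \<in> carrier A" "y \<in> carrier A" for x y
  proof (rule t.thetaI)
    show "coboundary1 A V \<rho> \<mu> \<phi> x y \<oplus>\<^bsub>V\<^esub> \<theta> x y \<in> carrier V"
      using xy by (simp add: coboundary1_def)
    have "t x \<otimes>\<^bsub>E\<^esub> t y = s (x \<otimes>\<^bsub>A\<^esub> y) \<oplus>\<^bsub>E\<^esub> \<iota> (\<theta> x y) \<oplus>\<^bsub>E\<^esub> \<iota> (\<rho> x (\<phi> y)) \<oplus>\<^bsub>E\<^esub> \<iota> (\<mu> y (\<phi> x))"
      using xy by (simp add: t_def E.mult.simps section_mult iota_mult iota_rho iota_mu E.M.a_ac)
    moreover have "t (x \<otimes>\<^bsub>A\<^esub> y) = s (x \<otimes>\<^bsub>A\<^esub> y) \<oplus>\<^bsub>E\<^esub> \<iota> (\<phi> (x \<otimes>\<^bsub>A\<^esub> y))"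
      by (simp add: t_def)
    moreover have "\<iota> (coboundary1 A V \<rho> \<mu> \<phi> x y \<oplus>\<^bsub>V\<^esub> \<theta> x y)
      = \<iota> (\<rho> x (\<phi> y)) \<oplus>\<^bsub>E\<^esub> \<iota> (\<mu> y (\<phi> x)) \<ominus>\<^bsub>E\<^esub> \<iota> (\<phi> (x \<otimes>\<^bsub>A\<^esub> y)) \<oplus>\<^bsub>E\<^esub> \<iota> (\<theta> x y)"
      using xy by (simp add: coboundary1_def \<iota>.simps)
    moreover have "a \<oplus>\<^bsub>E\<^esub> b \<ominus>\<^bsub>E\<^esub> c \<oplus>\<^bsub>E\<^esub> d = m \<oplus>\<^bsub>E\<^esub> d \<oplus>\<^bsub>E\<^esub> a \<oplus>\<^bsub>E\<^esub> b \<ominus>\<^bsub>E\<^esub> (m \<oplus>\<^bsub>E\<^esub> c)"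
      if "a \<in> carrier E" "b \<in> carrier E" "c \<in> carrier E" "d \<in> carrier E" "m \<in> carrier E"
      for a b c d m
      using that by algebra
    ultimately show "\<iota> (coboundary1 A V \<rho> \<mu> \<phi> x y \<oplus>\<^bsub>V\<^esub> \<theta> x y) = t x \<otimes>\<^bsub>E\<^esub> t y \<ominus>\<^bsub>E\<^esub> t (x \<otimes>\<^bsub>A\<^esub> y)"
      using xy by simp
  qed (use xy in simp_all)
  then show "extension_cocycle A V (E, \<iota>, p) t =
      (\<lambda>x\<in>carrier A. \<lambda>y\<in>carrier A. coboundary1 A V \<rho> \<mu> \<phi> x y \<oplus>\<^bsub>V\<^esub> \<theta> x y)"
    unfolding t.\<theta>_def[symmetric] using t.theta_PiE
    by (intro ext) (auto simp: restrict_def PiE_def extensional_def Pi_iff)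
qed

lemma section_eq_add_cochain:
  assumes "extension_section K A (E, \<iota>, p) t"
  obtains \<phi> where "linear_map K A V \<phi>" "\<And>x. x \<in> carrier A \<Longrightarrow> t x = s x \<oplus>\<^bsub>E\<^esub> \<iota> (\<phi> x)"
proof -
  interpret t: anti_pre_lie_extension_section K A V \<rho> \<mu> E \<iota> p t
    using assms by unfold_locales
  have ex: "\<exists>u. u \<in> carrier V \<and> t x = s x \<oplus>\<^bsub>E\<^esub> \<iota> u" if x: "x \<in> carrier A" for x
  proof -
    have "p (t x \<ominus>\<^bsub>E\<^esub> s x) = \<zero>\<^bsub>A\<^esub>"
      using x by (simp add: p.simps A.M.diff_eq_zero_iff)
    then obtain u where u: "u \<in> carrier V" "t x \<ominus>\<^bsub>E\<^esub> s x = \<iota> u"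
      using x kernelE[of "t x \<ominus>\<^bsub>E\<^esub> s x"] by auto
    have "t x = s x \<oplus>\<^bsub>E\<^esub> \<iota> u"
      using x by (simp add: E.M.add_diff_cancel flip: u(2))
    then show ?thesis
      using u(1) by blast
  qed
  define \<phi> where "\<phi> x = (SOME u. u \<in> carrier V \<and> t x = s x \<oplus>\<^bsub>E\<^esub> \<iota> u)" for x
  have \<phi>: "\<phi> x \<in> carrier V" "t x = s x \<oplus>\<^bsub>E\<^esub> \<iota> (\<phi> x)" if "x \<in> carrier A" for x
    using someI_ex[OF ex[OF that]] by (simp_all add: \<phi>_def)
  \<comment> \<open>By injectivity of \<open>\<iota>\<close> the chosen value is the only one, so
    linearity of \<open>\<phi>\<close> follows from that of the two sections.\<close>
  have \<phi>I: "\<phi> x = u" if "x \<in> carrier A" "u \<in> carrier V" "t x = s x \<oplus>\<^bsub>E\<^esub> \<iota> u" for x u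
    using \<phi>[OF that(1)] that iota_eq_iff by simp
  have "linear_map K A V \<phi>"
  proof (rule linear_mapI)
    show "\<phi> (x \<oplus>\<^bsub>A\<^esub> y) = \<phi> x \<oplus>\<^bsub>V\<^esub> \<phi> y" if xy: "x \<in> carrier A" "y \<in> carrier A" for x y
      using xy \<phi>(2)[OF xy(1)] \<phi>(2)[OF xy(2)]
      by (intro \<phi>I) (simp_all add: \<phi>(1) t.s.simps s.simps \<iota>.simps E.M.a_ac)
    show "\<phi> (a \<odot>\<^bsub>A\<^esub> x) = a \<odot>\<^bsub>V\<^esub> \<phi> x" if ax: "a \<in> carrier K" "x \<in> carrier A" for a x
      using ax \<phi>(2)[OF ax(2)]
      by (intro \<phi>I) (simp_all add: \<phi>(1) t.s.simps s.simps \<iota>.simps E.smult_r_distr)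
  qed (rule \<phi>(1))
  then show ?thesis
    using that \<phi>(2) by blast
qed

end

text \<open>Sections are not extensional functions, so \<open>t\<close> and \<open>s\<close> plus a
  cochain agree only on the carrier; this passes from that agreement to equality of
  cocycles.\<close>

lemma extension_cocycle_cong:
  assumes "\<And>x. x \<in> carrier A \<Longrightarrow> s x = t x"
    and "\<And>x y. \<lbrakk>x \<in> carrier A; y \<in> carrier A\<rbrakk> \<Longrightarrow> x \<otimes>\<^bsub>A\<^esub> y \<in> carrier A"
  shows "extension_cocycle A V X s = extension_cocycle A V X t"
  using assms by (auto simp: extension_cocycle_def restrict_def split: prod.split intro!: ext)

subsection \<open>Cohomology classes and the classification\<close>

context anti_pre_lie_representation
begin

section \<open>Classes modulo coboundaries\<close>

lemma linear_map_pointwise: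
  assumes "linear_map K A V \<phi>" "linear_map K A V \<psi>"
  shows "linear_map K A V (\<lambda>x. \<phi> x \<oplus>\<^bsub>V\<^esub> \<psi> x)"
    and "linear_map K A V (\<lambda>x. \<ominus>\<^bsub>V\<^esub> \<phi> x)"
proof -
  interpret \<phi>: linear_mapping K A V \<phi> + \<psi>: linear_mapping K A V \<psi>
    using assms by unfold_locales
  show "linear_map K A V (\<lambda>x. \<phi> x \<oplus>\<^bsub>V\<^esub> \<psi> x)"
    by (rule linear_mapI) (simp_all add: \<phi>.simps \<psi>.simps V.smult_r_distr V.M.a_ac)
  show "linear_map K A V (\<lambda>x. \<ominus>\<^bsub>V\<^esub> \<phi> x)"
    by (rule linear_mapI) (simp_all add: \<phi>.simps V.smult_r_minus V.M.minus_add)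
qed

lemma coboundary1_pointwise:
  assumes "linear_map K A V \<phi>" "linear_map K A V \<psi>" and xy: "x \<in> carrier A" "y \<in> carrier A"
  shows "coboundary1 A V \<rho> \<mu> (\<lambda>x. \<phi> x \<oplus>\<^bsub>V\<^esub> \<psi> x) x y
      = coboundary1 A V \<rho> \<mu> \<phi> x y \<oplus>\<^bsub>V\<^esub> coboundary1 A V \<rho> \<mu> \<psi> x y"
    and "coboundary1 A V \<rho> \<mu> (\<lambda>x. \<ominus>\<^bsub>V\<^esub> \<phi> x) x y = \<ominus>\<^bsub>V\<^esub> coboundary1 A V \<rho> \<mu> \<phi> x y"
    and "coboundary1 A V \<rho> \<mu> (\<lambda>x. \<zero>\<^bsub>V\<^esub>) x y = \<zero>\<^bsub>V\<^esub>"
    and "coboundary1 A V \<rho> \<mu> \<phi> x y \<in> carrier V"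
proof -
  interpret \<phi>: linear_mapping K A V \<phi> + \<psi>: linear_mapping K A V \<psi>
    using assms by unfold_locales
  show "coboundary1 A V \<rho> \<mu> (\<lambda>x. \<phi> x \<oplus>\<^bsub>V\<^esub> \<psi> x) x y
      = coboundary1 A V \<rho> \<mu> \<phi> x y \<oplus>\<^bsub>V\<^esub> coboundary1 A V \<rho> \<mu> \<psi> x y"
    "coboundary1 A V \<rho> \<mu> (\<lambda>x. \<ominus>\<^bsub>V\<^esub> \<phi> x) x y = \<ominus>\<^bsub>V\<^esub> coboundary1 A V \<rho> \<mu> \<phi> x y"
    "coboundary1 A V \<rho> \<mu> (\<lambda>x. \<zero>\<^bsub>V\<^esub>) x y = \<zero>\<^bsub>V\<^esub>"
    "coboundary1 A V \<rho> \<mu> \<phi> x y \<in> carrier V"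
    using xy
    by (simp_all add: coboundary1_def \<rho>.simps \<mu>.simps V.M.minus_add V.M.a_ac a_minus_def)
qed

text \<open>Cosets are handled through this explicit form, without appeal to group laws for
  \<open>cocycle_space2\<close>.\<close>

lemma mem_cohomology_class2:
  "g \<in> cohomology_class2 K A V \<rho> \<mu> f \<longleftrightarrow> (\<exists>\<phi>. linear_map K A V \<phi> \<and>
    g = (\<lambda>x\<in>carrier A. \<lambda>y\<in>carrier A. coboundary1 A V \<rho> \<mu> \<phi> x y \<oplus>\<^bsub>V\<^esub> f x y))"
  by (auto simp: cohomology_class2_def a_r_coset_def' coboundaries2_def cocycle_space2_def)

text \<open>The zero cochain is the witness; extensionality of cocycles turns agreement on the
  carriers into equality.\<close>

lemma cohomology_class2_self:
  assumes "f \<in> cocycles2 K A V \<rho> \<mu>"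
  shows "f \<in> cohomology_class2 K A V \<rho> \<mu> f"
proof -
  have zero: "linear_map K A V (\<lambda>x. \<zero>\<^bsub>V\<^esub>)"
    by (rule linear_mapI) simp_all
  have "f \<in> carrier A \<rightarrow>\<^sub>E (carrier A \<rightarrow>\<^sub>E carrier V)"
    using assms by (simp add: cocycles2_def)
  then have "f = (\<lambda>x\<in>carrier A. \<lambda>y\<in>carrier A. coboundary1 A V \<rho> \<mu> (\<lambda>x. \<zero>\<^bsub>V\<^esub>) x y \<oplus>\<^bsub>V\<^esub> f x y)"
    by (intro ext)
      (auto simp: coboundary1_pointwise(3)[OF zero zero] restrict_def PiE_def extensional_def Pi_iff)
  then show ?thesis
    unfolding mem_cohomology_class2 using zero by blast
qed

text \<open>Adding cochains gives one inclusion; negating the cochain that relates \<open>g\<close>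
  to \<open>f\<close> gives the other.\<close>

lemma cohomology_class2_eqI:
  assumes f: "f \<in> cocycles2 K A V \<rho> \<mu>" and g: "g \<in> cohomology_class2 K A V \<rho> \<mu> f"
  shows "cohomology_class2 K A V \<rho> \<mu> g = cohomology_class2 K A V \<rho> \<mu> f"
proof -
  have fE: "f \<in> carrier A \<rightarrow>\<^sub>E (carrier A \<rightarrow>\<^sub>E carrier V)"
    using f by (simp add: cocycles2_def)
  have f_closed: "f x y \<in> carrier V" if "x \<in> carrier A" "y \<in> carrier A" for x y
    using fE that by auto
  \<comment> \<open>Asking only for values in \<open>V\<close> lets this be used with
    \<open>g\<close> in the role of \<open>h\<close>, where the cocycle property of \<open>g\<close>
    is not at hand.\<close>
  have trans: "cohomology_class2 K A V \<rho> \<mu> g \<subseteq> cohomology_class2 K A V \<rho> \<mu> h"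
    if gh: "g \<in> cohomology_class2 K A V \<rho> \<mu> h"
      and h: "\<And>x y. \<lbrakk>x \<in> carrier A; y \<in> carrier A\<rbrakk> \<Longrightarrow> h x y \<in> carrier V" for g h
  proof
    fix k assume "k \<in> cohomology_class2 K A V \<rho> \<mu> g"
    then obtain \<psi> where \<psi>: "linear_map K A V \<psi>"
      "k = (\<lambda>x\<in>carrier A. \<lambda>y\<in>carrier A. coboundary1 A V \<rho> \<mu> \<psi> x y \<oplus>\<^bsub>V\<^esub> g x y)"
      by (auto simp: mem_cohomology_class2)
    obtain \<phi> where \<phi>: "linear_map K A V \<phi>"
      "g = (\<lambda>x\<in>carrier A. \<lambda>y\<in>carrier A. coboundary1 A V \<rho> \<mu> \<phi> x y \<oplus>\<^bsub>V\<^esub> h x y)"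
      using gh by (auto simp: mem_cohomology_class2)
    have "k = (\<lambda>x\<in>carrier A. \<lambda>y\<in>carrier A.
        coboundary1 A V \<rho> \<mu> (\<lambda>x. \<psi> x \<oplus>\<^bsub>V\<^esub> \<phi> x) x y \<oplus>\<^bsub>V\<^esub> h x y)"
      unfolding \<psi>(2) \<phi>(2)
      by (intro restrict_ext)
        (simp add: coboundary1_pointwise(1)[OF \<psi>(1) \<phi>(1)] coboundary1_pointwise(4)[OF \<psi>(1) \<psi>(1)]
          coboundary1_pointwise(4)[OF \<phi>(1) \<phi>(1)] h V.M.a_assoc)
    then show "k \<in> cohomology_class2 K A V \<rho> \<mu> h"
      unfolding mem_cohomology_class2 using linear_map_pointwise(1)[OF \<psi>(1) \<phi>(1)] by blast
  qed
  obtain \<phi> where \<phi>: "linear_map K A V \<phi>"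
    "g = (\<lambda>x\<in>carrier A. \<lambda>y\<in>carrier A. coboundary1 A V \<rho> \<mu> \<phi> x y \<oplus>\<^bsub>V\<^esub> f x y)"
    using g by (auto simp: mem_cohomology_class2)
  have g_closed: "g x y \<in> carrier V" if "x \<in> carrier A" "y \<in> carrier A" for x y
    using that f_closed by (simp add: \<phi>(2) coboundary1_pointwise(4)[OF \<phi>(1) \<phi>(1)])
  have "f = (\<lambda>x\<in>carrier A. \<lambda>y\<in>carrier A.
      coboundary1 A V \<rho> \<mu> (\<lambda>x. \<ominus>\<^bsub>V\<^esub> \<phi> x) x y \<oplus>\<^bsub>V\<^esub> g x y)"
    using fE f_closed unfolding \<phi>(2)
    by (intro ext)
      (auto simp: coboundary1_pointwise(2,4)[OF \<phi>(1) \<phi>(1)] V.M.r_neg1 restrict_def PiE_def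
        extensional_def Pi_iff)
  then have "f \<in> cohomology_class2 K A V \<rho> \<mu> g"
    unfolding mem_cohomology_class2 using linear_map_pointwise(2)[OF \<phi>(1) \<phi>(1)] by blast
  then show ?thesis
    using trans[OF g f_closed] trans[of f g] g_closed by blast
qed

lemma extensionsE:
  assumes "X \<in> extensions K A V \<rho> \<mu>"
  obtains E \<iota> p where "X = (E, \<iota>, p)" "anti_pre_lie_extension K A V \<rho> \<mu> E \<iota> p"
  using assms that
  by (metis anti_pre_lie_extension_axioms.intro anti_pre_lie_extension_def
      anti_pre_lie_representation_axioms prod_cases3)

lemma anti_pre_lie_extension_sectionI:
  assumes "(E, \<iota>, p) \<in> extensions K A V \<rho> \<mu>" "extension_section K A (E, \<iota>, p) s"
  shows "anti_pre_lie_extension_section K A V \<rho> \<mu> E \<iota> p s"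
  using assms anti_pre_lie_representation_axioms
  by (simp add: anti_pre_lie_extension_section_def anti_pre_lie_extension_def
      anti_pre_lie_extension_axioms_def anti_pre_lie_extension_section_axioms_def)

section \<open>The class of an extension\<close>

lemma extension_section_exists:
  assumes "X \<in> extensions K A V \<rho> \<mu>"
  shows "\<exists>s. extension_section K A X s"
  using assms anti_pre_lie_extension.section_exists by (metis extensionsE)

lemma extension_cocycle_cocycle:
  assumes "X \<in> extensions K A V \<rho> \<mu>" "extension_section K A X s"
  shows "extension_cocycle A V X s \<in> cocycles2 K A V \<rho> \<mu>"
proof -
  obtain E \<iota> p where X: "X = (E, \<iota>, p)"
    using prod_cases3 by blast
  interpret anti_pre_lie_extension_section K A V \<rho> \<mu> E \<iota> p s
    using assms unfolding X by (rule anti_pre_lie_extension_sectionI)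
  show ?thesis
    using theta_cocycle by (simp add: X \<theta>_def)
qed

lemma cohomology_class2_section_independent:
  assumes "X \<in> extensions K A V \<rho> \<mu>" "extension_section K A X s" "extension_section K A X t"
  shows "cohomology_class2 K A V \<rho> \<mu> (extension_cocycle A V X t)
    = cohomology_class2 K A V \<rho> \<mu> (extension_cocycle A V X s)"
proof -
  obtain E \<iota> p where X: "X = (E, \<iota>, p)"
    using prod_cases3 by blast
  interpret anti_pre_lie_extension_section K A V \<rho> \<mu> E \<iota> p s
    using assms(1,2) unfolding X by (rule anti_pre_lie_extension_sectionI)
  obtain \<phi> where \<phi>: "linear_map K A V \<phi>" "\<And>x. x \<in> carrier A \<Longrightarrow> t x = s x \<oplus>\<^bsub>E\<^esub> \<iota> (\<phi> x)"
    using section_eq_add_cochain assms(3) unfolding X by blast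
  have "extension_cocycle A V X t = extension_cocycle A V X (\<lambda>x. s x \<oplus>\<^bsub>E\<^esub> \<iota> (\<phi> x))"
    by (rule extension_cocycle_cong) (simp_all add: \<phi>(2))
  then have "extension_cocycle A V X t \<in> cohomology_class2 K A V \<rho> \<mu> \<theta>"
    unfolding mem_cohomology_class2 X section_add_cochain(2)[OF \<phi>(1)] using \<phi>(1) by blast
  then show ?thesis
    using cohomology_class2_eqI[OF theta_cocycle] by (simp add: X \<theta>_def)
qed

text \<open>The section is pushed forward along \<open>\<zeta>\<close>. Its defect is the image of
  the old one, and since \<open>\<zeta>\<close> matches the two embeddings of \<open>V\<close>, both
  defects come from the same element of \<open>V\<close>.\<close>

lemma extension_isomorphic_section:
  assumes X: "X \<in> extensions K A V \<rho> \<mu>" and Y: "Y \<in> extensions K A V \<rho> \<mu>"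
    and iso: "extension_isomorphic K V X Y" and s: "extension_section K A X s"
  obtains t where "extension_section K A Y t"
    "extension_cocycle A V Y t = extension_cocycle A V X s"
proof -
  obtain E1 \<iota>1 p1 E2 \<iota>2 p2 where XY: "X = (E1, \<iota>1, p1)" "Y = (E2, \<iota>2, p2)"
    using prod_cases3 by metis
  interpret X: anti_pre_lie_extension_section K A V \<rho> \<mu> E1 \<iota>1 p1 s
    using X s unfolding XY by (rule anti_pre_lie_extension_sectionI)
  obtain \<zeta> where \<zeta>: "algebra_hom K E1 E2 \<zeta>" "\<And>u. u \<in> carrier V \<Longrightarrow> \<zeta> (\<iota>1 u) = \<iota>2 u"
    "\<And>e. e \<in> carrier E1 \<Longrightarrow> p2 (\<zeta> e) = p1 e"
    using iso unfolding XY extension_isomorphic_def by auto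
  note \<zeta>_hom = linear_mapD[OF algebra_hom_linear[OF \<zeta>(1)]] algebra_hom_mult[OF \<zeta>(1)]
  have t: "extension_section K A Y (\<zeta> \<circ> s)"
    unfolding XY extension_section_def split_conv
    by (intro conjI ballI linear_mapI) (simp_all add: \<zeta> \<zeta>_hom X.s.simps)
  interpret Y: anti_pre_lie_extension_section K A V \<rho> \<mu> E2 \<iota>2 p2 "\<zeta> \<circ> s"
    using Y t unfolding XY by (rule anti_pre_lie_extension_sectionI)
  interpret \<zeta>: linear_mapping K E1 E2 \<zeta>
    using algebra_hom_linear[OF \<zeta>(1)] by unfold_locales
  have "Y.\<theta> x y = X.\<theta> x y" if "x \<in> carrier A" "y \<in> carrier A" for x y
    using that by (intro Y.thetaI) (simp_all add: X.iota_theta \<zeta>.simps \<zeta>_hom(4) flip: \<zeta>(2))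
  then have "Y.\<theta> = X.\<theta>"
    by (intro PiE_ext[OF Y.theta_PiE X.theta_PiE] PiE_ext[OF PiE_mem[OF Y.theta_PiE]
          PiE_mem[OF X.theta_PiE]])
  then show ?thesis
    using that t by (simp add: XY X.\<theta>_def Y.\<theta>_def)
qed

lemma twisted_product_extension:
  assumes f: "f \<in> cocycles2 K A V \<rho> \<mu>"
  defines "X \<equiv> (twisted_product f, \<lambda>u. (\<zero>\<^bsub>A\<^esub>, u), fst)"
  shows "X \<in> extensions K A V \<rho> \<mu>"
    and "extension_section K A X (\<lambda>x. (x, \<zero>\<^bsub>V\<^esub>))"
    and "extension_cocycle A V X (\<lambda>x. (x, \<zero>\<^bsub>V\<^esub>)) = f"
proof -
  have fE: "f \<in> carrier A \<rightarrow>\<^sub>E (carrier A \<rightarrow>\<^sub>E carrier V)"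
    using f by (simp add: cocycles2_def)
  interpret f: bilinear_mapping K A A V f
    using f by unfold_locales (simp add: cocycles2_def)
  have alg: "anti_pre_lie_algebra K (twisted_product f)"
    using anti_pre_lie_algebra_twisted_product_iff[OF f.bilinear fE] f by simp
  have "algebra_hom K (zero_product V) (twisted_product f) (\<lambda>u. (\<zero>\<^bsub>A\<^esub>, u))"
    unfolding algebra_hom_def
    by (intro conjI ballI linear_mapI)
      (simp_all add: zero_product_def mult.simps f.simps \<rho>.simps \<mu>.simps)
  moreover have "algebra_hom K (twisted_product f) A fst"
    unfolding algebra_hom_def by (intro conjI ballI linear_mapI) auto
  moreover have "(\<lambda>u. (\<zero>\<^bsub>A\<^esub>, u)) ` carrier V = a_kernel (twisted_product f) A fst"
    by (auto simp: a_kernel_def kernel_def)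
  moreover have "fst ` carrier (twisted_product f) = carrier A"
    using V.M.zero_closed by (auto simp: image_iff)
  ultimately have "abelian_extension K A V X"
    using alg by (simp add: X_def abelian_extension_def inj_on_def)
  moreover have "induces_representation K A V \<rho> \<mu> X"
    unfolding X_def induces_representation_def split_conv
  proof (intro allI impI ballI)
    fix s x u
    assume "extension_section K A (twisted_product f, \<lambda>u. (\<zero>\<^bsub>A\<^esub>, u), fst) s"
      and xu: "x \<in> carrier A" "u \<in> carrier V"
    then have "s x \<in> carrier A \<times> carrier V" "fst (s x) = x"
      using linear_map_closed[of K A "twisted_product f" s x]
      by (simp_all add: extension_section_def)
    \<comment> \<open>The unknown component \<open>v\<close> of the section is annihilated, because
      it is acted on by the zero of \<open>A\<close>.\<close>
    then obtain v where "s x = (x, v)" "v \<in> carrier V"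
      by (cases "s x") auto
    then show "(\<zero>\<^bsub>A\<^esub>, \<rho> x u) = s x \<otimes>\<^bsub>twisted_product f\<^esub> (\<zero>\<^bsub>A\<^esub>, u)
        \<and> (\<zero>\<^bsub>A\<^esub>, \<mu> x u) = (\<zero>\<^bsub>A\<^esub>, u) \<otimes>\<^bsub>twisted_product f\<^esub> s x"
      using xu by (simp add: mult.simps f.simps \<rho>.simps \<mu>.simps)
  qed
  ultimately show X: "X \<in> extensions K A V \<rho> \<mu>"
    by (simp add: extensions_def)
  show s: "extension_section K A X (\<lambda>x. (x, \<zero>\<^bsub>V\<^esub>))"
    unfolding X_def extension_section_def split_conv
    by (intro conjI ballI linear_mapI) simp_all
  interpret X: anti_pre_lie_extension_section K A V \<rho> \<mu> "twisted_product f" "\<lambda>u. (\<zero>\<^bsub>A\<^esub>, u)" fst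
    "\<lambda>x. (x, \<zero>\<^bsub>V\<^esub>)"
    using X s unfolding X_def by (rule anti_pre_lie_extension_sectionI)
  have "X.\<theta> x y = f x y" if "x \<in> carrier A" "y \<in> carrier A" for x y
    using that by (intro X.thetaI)
      (simp_all add: \<rho>.simps \<mu>.simps A.M.diff_eq_zero_iff A.M.r_neg a_minus_def)
  then have "X.\<theta> = f"
    by (intro PiE_ext[OF X.theta_PiE fE] PiE_ext[OF PiE_mem[OF X.theta_PiE] PiE_mem[OF fE]])
  then show "extension_cocycle A V X (\<lambda>x. (x, \<zero>\<^bsub>V\<^esub>)) = f"
    by (simp add: X_def X.\<theta>_def)
qed

text \<open>Both extensions are isomorphic to the twisted product of the common cocycle.\<close>

lemma extension_isomorphic_if_cocycle_eq:
  assumes X: "X \<in> extensions K A V \<rho> \<mu>" and Y: "Y \<in> extensions K A V \<rho> \<mu>"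
    and s: "extension_section K A X s" and t: "extension_section K A Y t"
    and eq: "extension_cocycle A V X s = extension_cocycle A V Y t"
  shows "extension_isomorphic K V X Y"
proof -
  obtain E1 \<iota>1 p1 E2 \<iota>2 p2 where XY: "X = (E1, \<iota>1, p1)" "Y = (E2, \<iota>2, p2)"
    using prod_cases3 by metis
  interpret X: anti_pre_lie_extension_section K A V \<rho> \<mu> E1 \<iota>1 p1 s
    using X s unfolding XY by (rule anti_pre_lie_extension_sectionI)
  interpret Y: anti_pre_lie_extension_section K A V \<rho> \<mu> E2 \<iota>2 p2 t
    using Y t unfolding XY by (rule anti_pre_lie_extension_sectionI)
  have \<theta>: "Y.\<theta> = X.\<theta>"
    using eq by (simp add: XY X.\<theta>_def Y.\<theta>_def)
  have "extension_isomorphic K V X (twisted_product X.\<theta>, \<lambda>u. (\<zero>\<^bsub>A\<^esub>, u), fst)"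
    unfolding XY
  proof (rule extension_isomorphic_sym[OF _ X.extension_isomorphic_twisted_product])
    show "abelian_extension K A V (twisted_product X.\<theta>, \<lambda>u. (\<zero>\<^bsub>A\<^esub>, u), fst)"
      using twisted_product_extension(1)[OF X.theta_cocycle] by (simp add: extensions_def)
  qed
  then show ?thesis
    using extension_isomorphic_trans Y.extension_isomorphic_twisted_product
    by (metis XY(2) \<theta>)
qed

text \<open>The twisted product has the required cocycle but lives on pairs. Its copy along
  \<open>j\<close> is an isomorphic extension, and pushing the section forward preserves the
  cocycle.\<close>

lemma extension_with_cocycle:
  fixes j :: "'a \<times> 'v \<Rightarrow> 'e"
  assumes f: "f \<in> cocycles2 K A V \<rho> \<mu>" and j: "inj_on j (carrier A \<times> carrier V)"
  obtains X :: "('k, 'a, 'v, 'e) extension" and s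
  where "X \<in> extensions K A V \<rho> \<mu>" "extension_section K A X s" "extension_cocycle A V X s = f"
proof -
  let ?X = "(twisted_product f, \<lambda>u. (\<zero>\<^bsub>A\<^esub>, u), fst)"
  let ?Y = "(transport_algebra j (twisted_product f), j \<circ> (\<lambda>u. (\<zero>\<^bsub>A\<^esub>, u)),
    fst \<circ> the_inv_into (carrier (twisted_product f)) j)"
  note X = twisted_product_extension[OF f]
  interpret X: anti_pre_lie_extension K A V \<rho> \<mu> "twisted_product f" "\<lambda>u. (\<zero>\<^bsub>A\<^esub>, u)" fst
    using X(1) by unfold_locales
  have "inj_on j (carrier (twisted_product f))"
    using j by simp
  note transport = transport_algebra[OF X.E.anti_pre_lie_algebra_axioms this]
  note Y = X.extensions_transport[OF transport]
  obtain t where t: "extension_section K A ?Y t"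
    "extension_cocycle A V ?Y t = extension_cocycle A V ?X (\<lambda>x. (x, \<zero>\<^bsub>V\<^esub>))"
    by (rule extension_isomorphic_section[OF X(1) Y X(2)])
  show ?thesis
    using that[OF Y(1) t(1)] t(2) X(3) by simp
qed

lemma extension_isomorphic_iff_cohomology_class2:
  assumes X: "X \<in> extensions K A V \<rho> \<mu>" and Y: "Y \<in> extensions K A V \<rho> \<mu>"
    and s: "extension_section K A X s" and t: "extension_section K A Y t"
  shows "extension_isomorphic K V X Y \<longleftrightarrow>
    cohomology_class2 K A V \<rho> \<mu> (extension_cocycle A V X s)
      = cohomology_class2 K A V \<rho> \<mu> (extension_cocycle A V Y t)"
proof
  assume "extension_isomorphic K V X Y"
  then obtain t' where "extension_section K A Y t'"
    "extension_cocycle A V Y t' = extension_cocycle A V X s"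
    using extension_isomorphic_section[OF X Y] s by blast
  then show "cohomology_class2 K A V \<rho> \<mu> (extension_cocycle A V X s)
      = cohomology_class2 K A V \<rho> \<mu> (extension_cocycle A V Y t)"
    using cohomology_class2_section_independent[OF Y t] by metis
next
  assume "cohomology_class2 K A V \<rho> \<mu> (extension_cocycle A V X s)
      = cohomology_class2 K A V \<rho> \<mu> (extension_cocycle A V Y t)"
  then have mem: "extension_cocycle A V Y t \<in> cohomology_class2 K A V \<rho> \<mu> (extension_cocycle A V X s)"
    using cohomology_class2_self[OF extension_cocycle_cocycle[OF Y t]] by simp
  obtain E \<iota> p where X_def: "X = (E, \<iota>, p)"
    using prod_cases3 by blast
  interpret X: anti_pre_lie_extension_section K A V \<rho> \<mu> E \<iota> p s
    using X s unfolding X_def by (rule anti_pre_lie_extension_sectionI)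
  obtain \<phi> where \<phi>: "linear_map K A V \<phi>" and eq: "extension_cocycle A V Y t
    = (\<lambda>x\<in>carrier A. \<lambda>y\<in>carrier A. coboundary1 A V \<rho> \<mu> \<phi> x y \<oplus>\<^bsub>V\<^esub> X.\<theta> x y)"
    using mem by (auto simp: mem_cohomology_class2 X_def X.\<theta>_def)
  \<comment> \<open>Changing the section of \<open>X\<close> by \<open>\<phi>\<close> makes the two
    cocycles equal, not merely cohomologous.\<close>
  show "extension_isomorphic K V X Y"
    using extension_isomorphic_if_cocycle_eq[OF X Y _ t] X.section_add_cochain[OF \<phi>] eq
    by (metis X_def)
qed

lemma equiv_extension_iso_rel:
  "equiv (extensions K A V \<rho> \<mu>) (extension_iso_rel K A V \<rho> \<mu>)"
proof (rule equivI)
  show "sym (extension_iso_rel K A V \<rho> \<mu>)"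
    using extension_isomorphic_sym by (fastforce simp: sym_def extension_iso_rel_def extensions_def)
  show "trans (extension_iso_rel K A V \<rho> \<mu>)"
    using extension_isomorphic_trans by (fastforce simp: trans_def extension_iso_rel_def)
qed (auto simp: refl_on_def extension_iso_rel_def extension_isomorphic_refl)

end

theorem theorem5p8:
  fixes K :: "('k, 'm) ring_scheme"
    and A :: "('k, 'a) module"
    and V :: "('k, 'v) module"
    and \<rho> \<mu> :: "'a \<Rightarrow> 'v \<Rightarrow> 'v"
    and j :: "'a \<times> 'v \<Rightarrow> 'e"
  assumes "anti_pre_lie_representation K A V \<rho> \<mu>"
    \<comment> \<open>the type \<open>'e\<close> containing the carriers of the extensions is large enough\<close>
    and "inj_on j (carrier A \<times> carrier V)"
  shows
    "let Ext = (extensions K A V \<rho> \<mu> :: ('k, 'a, 'v, 'e) extension set);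
         Iso = (extension_iso_rel K A V \<rho> \<mu> :: ('k, 'a, 'v, 'e) extension rel)
     in equiv Ext Iso \<and>
        (\<forall>X \<in> Ext. \<exists>s. extension_section K A X s) \<and>
        (\<forall>X \<in> Ext. \<forall>s. extension_section K A X s \<longrightarrow>
           extension_cocycle A V X s \<in> cocycles2 K A V \<rho> \<mu>) \<and>
        (\<exists>\<Phi>. bij_betw \<Phi> (Ext // Iso) (cohomology2 K A V \<rho> \<mu>) \<and>
           (\<forall>X \<in> Ext. \<forall>s. extension_section K A X s \<longrightarrow>
              \<Phi> (Iso `` {X}) = cohomology_class2 K A V \<rho> \<mu> (extension_cocycle A V X s)))"
proof -
  interpret anti_pre_lie_representation K A V \<rho> \<mu> by fact
  define Ext where "Ext = (extensions K A V \<rho> \<mu> :: ('k, 'a, 'v, 'e) extension set)"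
  define Iso where "Iso = (extension_iso_rel K A V \<rho> \<mu> :: ('k, 'a, 'v, 'e) extension rel)"
  have equiv: "equiv Ext Iso"
    unfolding Ext_def Iso_def by (rule equiv_extension_iso_rel)
  have ex_section: "\<exists>s. extension_section K A X s" if "X \<in> Ext" for X
    using that unfolding Ext_def by (rule extension_section_exists)
  \<comment> \<open>The chosen section is immaterial: the next fact replaces it by any
    other.\<close>
  define cls where "cls X = cohomology_class2 K A V \<rho> \<mu>
    (extension_cocycle A V X (SOME s. extension_section K A X s))" for X :: "('k, 'a, 'v, 'e) extension"
  have cls: "cls X = cohomology_class2 K A V \<rho> \<mu> (extension_cocycle A V X s)"
    if "X \<in> Ext" "extension_section K A X s" for X s
    using that unfolding cls_def Ext_def
    by (intro cohomology_class2_section_independent someI[of "extension_section K A X"])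
  have cls_eq_iff: "cls X = cls Y \<longleftrightarrow> (X, Y) \<in> Iso" if "X \<in> Ext" "Y \<in> Ext" for X Y
  proof -
    obtain s t where "extension_section K A X s" "extension_section K A Y t"
      using ex_section \<open>X \<in> Ext\<close> \<open>Y \<in> Ext\<close> by blast
    then show ?thesis
      using that extension_isomorphic_iff_cohomology_class2[of X Y s t]
      by (auto simp: cls Ext_def Iso_def extension_iso_rel_def)
  qed
  \<comment> \<open>A representative is chosen; \<open>cls_eq_iff\<close> makes the value
    independent of it and, read the other way, makes the map injective. Since sections exist, the
    last clause of the theorem determines this map on all isomorphism classes.\<close>
  define \<Phi> where "\<Phi> C = cls (SOME X. X \<in> C)" for C
  have \<Phi>: "\<Phi> (Iso `` {X}) = cls X" if X: "X \<in> Ext" for X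
  proof -
    have "X \<in> Iso `` {X}"
      by (rule equiv_class_self[OF equiv X])
    then have "(SOME Y. Y \<in> Iso `` {X}) \<in> Iso `` {X}"
      by (rule someI[where P = "\<lambda>Y. Y \<in> Iso `` {X}"])
    then have "(X, SOME Y. Y \<in> Iso `` {X}) \<in> Iso"
      by simp
    moreover then have "(SOME Y. Y \<in> Iso `` {X}) \<in> Ext"
      unfolding Iso_def Ext_def extension_iso_rel_def by blast
    ultimately show ?thesis
      using cls_eq_iff[OF X] unfolding \<Phi>_def by blast
  qed
  have "inj_on \<Phi> (Ext // Iso)"
  proof (rule inj_onI)
    fix C D assume "C \<in> Ext // Iso" "D \<in> Ext // Iso" and eq: "\<Phi> C = \<Phi> D"
    then obtain X Y where "C = Iso `` {X}" "D = Iso `` {Y}" "X \<in> Ext" "Y \<in> Ext"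
      by (auto elim!: quotientE)
    then show "C = D"
      using eq \<Phi> cls_eq_iff equiv_class_eq[OF equiv] by metis
  qed
  moreover have "\<Phi> ` (Ext // Iso) = cohomology2 K A V \<rho> \<mu>"
  proof -
    have cohomology2: "cohomology2 K A V \<rho> \<mu>
      = cohomology_class2 K A V \<rho> \<mu> ` cocycles2 K A V \<rho> \<mu>"
      by (auto simp: cohomology2_def cohomology_class2_def A_RCOSETS_def' cocycle_space2_def)
    have "\<Phi> ` (Ext // Iso) = cls ` Ext"
      by (force simp: quotient_def \<Phi> image_iff)
    also have "\<dots> = cohomology_class2 K A V \<rho> \<mu> ` cocycles2 K A V \<rho> \<mu>"
    proof
      show "cls ` Ext \<subseteq> cohomology_class2 K A V \<rho> \<mu> ` cocycles2 K A V \<rho> \<mu>"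
        using ex_section cls extension_cocycle_cocycle unfolding Ext_def by blast
      show "cohomology_class2 K A V \<rho> \<mu> ` cocycles2 K A V \<rho> \<mu> \<subseteq> cls ` Ext"
      proof
        fix C assume "C \<in> cohomology_class2 K A V \<rho> \<mu> ` cocycles2 K A V \<rho> \<mu>"
        then obtain f where f: "f \<in> cocycles2 K A V \<rho> \<mu>" "C = cohomology_class2 K A V \<rho> \<mu> f"
          by blast
        \<comment> \<open>Surjectivity is the point at which \<open>'e\<close> must have room for a
          twisted product.\<close>
        obtain X :: "('k, 'a, 'v, 'e) extension" and s
          where "X \<in> Ext" "extension_section K A X s" "extension_cocycle A V X s = f"
          using extension_with_cocycle[OF f(1) assms(2)] unfolding Ext_def by blast
        then show "C \<in> cls ` Ext"
          using cls f(2) by blast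
      qed
    qed
    finally show ?thesis
      by (simp add: cohomology2)
  qed
  ultimately have "bij_betw \<Phi> (Ext // Iso) (cohomology2 K A V \<rho> \<mu>)"
    by (simp add: bij_betw_def)
  moreover have "extension_cocycle A V X s \<in> cocycles2 K A V \<rho> \<mu>"
    if "X \<in> Ext" "extension_section K A X s" for X s
    using that unfolding Ext_def by (rule extension_cocycle_cocycle)
  ultimately show ?thesis
    unfolding Let_def Ext_def[symmetric] Iso_def[symmetric]
    using equiv ex_section \<Phi> cls by (intro conjI exI[of _ \<Phi>]) auto
qed

end
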